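(* Let $k\ge 2$. Suppose $\delta\in\mathbf{C}^*$ and $t_0^+,\dots,t_k^+\in\mathbf{C}$ are distinct parameters satisfying $\sum_{j=0}^k t_j^+\neq 0$. Then there exist a unique basic cremona map $F=S\circ J\circ T^{-1}:\mathbf{P}^k\dashrightarrow\mathbf{P}^k$ and a unique $\tau\in\mathbf{C}$ such that (i) $F$ properly fixes $C$, with $F|_C$ given by $F(\gamma(t))=\gamma(\delta t+\tau)$; and (ii) $T(\mathbf{e}_j)=\gamma(t_j^+)$ for each $0\le j\le k$. Specifically, $\tau=\frac{k-1}{k+1}\,\delta\sum_{j=0}^k t_j^+$, and $S(\mathbf{e}_j)=\gamma\left(\delta t_j^+-\frac{2\tau}{k-1}\right)$ for each $0\le j\le k$.
   Context: $\mathbf{P}^k$ is complex projective space with homogeneous coordinates $[x_0:\dots:x_k]$, and $\mathbf{e}_j\in\mathbf{P}^k$ is the point whose only nonzero coordinate is the $j$-th. $C\subset\mathbf{P}^k$ is the curve of degree $k+1$ parametrized by $\gamma:\mathbf{C}\cup\{\infty\}\to\mathbf{P}^k$, $\gamma(t)=[1:t:\dots:t^{k-1}:t^{k+1}]$, $\gamma(\infty)=[0:\dots:0:1]$; its only singular point is the cusp $\gamma(\infty)$ and $C_{reg}=\gamma(\mathbf{C})$. $J:\mathbf{P}^k\dashrightarrow\mathbf{P}^k$ is the birational involution $J[x_0:\dots:x_k]=[1/x_0:\dots:1/x_k]$ (multiplied through by $x_0\cdots x_k$). A basic cremona map is a birational map of the form $F=S\circ J\circ T^{-1}$ with $S,T\in\mathrm{Aut}(\mathbf{P}^k)$;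 $S$ and $T$ are determined by $F$ up to replacing $(S,T)$ by $(S\circ\Lambda,T\circ\Lambda)$ with $\Lambda$ a diagonal linear automorphism (and up to the corresponding labelling of the $\mathbf e_j$), and uniqueness of $F$ means uniqueness as a birational map. $F$ is centered on $C$ if $T(\mathbf{e}_j)\in C_{reg}$ for all $0\le j\le k$, and $F$ properly fixes $C$ if it is centered on $C$ and $F(C)=C$ (proper transform); $F|_C$ then denotes the induced automorphism of $C$. *)

theory Defs
  imports Complex_Main "Jordan_Normal_Form.Gauss_Jordan_Elimination"
begin

subsection \<open>Projective space\<close>

text \<open>A point of $P^k$ is the set of all nonzero multiples of a nonzero vector with $k+1$
  complex coordinates, which are numbered from 0 to k.\<close>

definition proj_pt :: "complex vec \<Rightarrow> complex vec set" where
  "proj_pt v = {c \<cdot>\<^sub>v v | c. c \<noteq> 0}"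

definition proj_space :: "nat \<Rightarrow> complex vec set set" where
  "proj_space k = proj_pt ` (carrier_vec (k + 1) - {0\<^sub>v (k + 1)})"

definition coord_pt :: "nat \<Rightarrow> nat \<Rightarrow> complex vec set" where
  "coord_pt k j = proj_pt (unit_vec (k + 1) j)"

text \<open>Automorphisms of $P^k$ are given by invertible matrices; a matrix acts on a point
  elementwise.\<close>

definition lin_auts :: "nat \<Rightarrow> complex mat set" where
  "lin_auts k = {A \<in> carrier_mat (k + 1) (k + 1). invertible_mat A}"

definition apply_aut :: "complex mat \<Rightarrow> complex vec set \<Rightarrow> complex vec set" where
  "apply_aut A p = (\<lambda>v. A *\<^sub>v v) ` p"

subsection \<open>Homogeneous polynomials\<close>

text \<open>Homogeneous polynomials of degree d in n variables, as functions: over the infinite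
  field of complex numbers, polynomials and polynomial functions on $C^n$ are the same thing.
  Only the values on \<open>carrier_vec n\<close> are meaningful.\<close>

inductive hom_poly :: "nat \<Rightarrow> nat \<Rightarrow> (complex vec \<Rightarrow> complex) \<Rightarrow> bool" for n where
  const: "hom_poly n 0 (\<lambda>v. c)"
| coord: "i < n \<Longrightarrow> hom_poly n 1 (\<lambda>v. v $ i)"
| add: "hom_poly n d p \<Longrightarrow> hom_poly n d q \<Longrightarrow> hom_poly n d (\<lambda>v. p v + q v)"
| mult: "hom_poly n d p \<Longrightarrow> hom_poly n e q \<Longrightarrow> hom_poly n (d + e) (\<lambda>v. p v * q v)"

text \<open>Tuples of $k+1$ homogeneous polynomials of the same degree in $k+1$ variables.\<close>

definition hom_poly_map :: "nat \<Rightarrow> nat \<Rightarrow> (complex vec \<Rightarrow> complex vec) \<Rightarrow> bool" where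
  "hom_poly_map k d f \<longleftrightarrow>
     (\<exists>p. (\<forall>i\<le>k. hom_poly (k + 1) d (p i)) \<and>
          (\<forall>v\<in>carrier_vec (k + 1). f v = vec (k + 1) (\<lambda>i. p i v)))"

definition zariski_closure :: "nat \<Rightarrow> complex vec set set \<Rightarrow> complex vec set set" where
  "zariski_closure k X =
     {p \<in> proj_space k. \<forall>d h. hom_poly (k + 1) d h \<longrightarrow>
        (\<forall>q\<in>X. \<forall>v\<in>q. h v = 0) \<longrightarrow> (\<forall>v\<in>p. h v = 0)}"

subsection \<open>Rational self-maps of projective space\<close>

text \<open>A rational map is the class of all tuples of homogeneous polynomials representing it.
  Tuples f and g, neither identically zero, represent the same rational map iff
  $f_i g_j = f_j g_i$ for all i and j. Representatives may have common factors.\<close>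

definition rat_rep :: "nat \<Rightarrow> (complex vec \<Rightarrow> complex vec) \<Rightarrow> bool" where
  "rat_rep k f \<longleftrightarrow> (\<exists>d. hom_poly_map k d f) \<and>
     (\<exists>v\<in>carrier_vec (k + 1). f v \<noteq> 0\<^sub>v (k + 1))"

definition rat_equiv ::
    "nat \<Rightarrow> (complex vec \<Rightarrow> complex vec) \<Rightarrow> (complex vec \<Rightarrow> complex vec) \<Rightarrow> bool" where
  "rat_equiv k f g \<longleftrightarrow> rat_rep k f \<and> rat_rep k g \<and>
     (\<forall>v\<in>carrier_vec (k + 1). \<forall>i\<le>k. \<forall>j\<le>k. f v $ i * g v $ j = f v $ j * g v $ i)"

type_synonym rat_map = "(complex vec \<Rightarrow> complex vec) set"

definition rat_class :: "nat \<Rightarrow> (complex vec \<Rightarrow> complex vec) \<Rightarrow> rat_map" where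
  "rat_class k f = {g. rat_equiv k f g}"

definition rat_maps :: "nat \<Rightarrow> rat_map set" where
  "rat_maps k = {rat_class k f | f. rat_rep k f}"

text \<open>The composition is the empty set, hence not a rational map, if it is undefined, i.e. if
  the substituted tuple always vanishes identically.\<close>

definition rat_comp :: "nat \<Rightarrow> rat_map \<Rightarrow> rat_map \<Rightarrow> rat_map" where
  "rat_comp k F G = {h. \<exists>f\<in>F. \<exists>g\<in>G. rat_equiv k (f \<circ> g) h}"

definition birational_map :: "nat \<Rightarrow> rat_map \<Rightarrow> bool" where
  "birational_map k F \<longleftrightarrow> F \<in> rat_maps k \<and>
     (\<exists>G\<in>rat_maps k. rat_comp k F G = rat_class k (\<lambda>v. v) \<and>
                     rat_comp k G F = rat_class k (\<lambda>v. v))"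

text \<open>The indeterminacy locus consists of the points at which all representatives vanish;
  elsewhere the value of the map is computed from any representative that does not vanish.\<close>

definition indet :: "nat \<Rightarrow> rat_map \<Rightarrow> complex vec set set" where
  "indet k F = {p \<in> proj_space k. \<forall>f\<in>F. \<forall>v\<in>p. f v = 0\<^sub>v (k + 1)}"

definition rat_eval :: "nat \<Rightarrow> rat_map \<Rightarrow> complex vec set \<Rightarrow> complex vec set" where
  "rat_eval k F p =
     (THE q. \<exists>f\<in>F. \<exists>v\<in>p. f v \<noteq> 0\<^sub>v (k + 1) \<and> q = proj_pt (f v))"

definition proper_transform ::
    "nat \<Rightarrow> rat_map \<Rightarrow> complex vec set set \<Rightarrow> complex vec set set" where
  "proper_transform k F X = zariski_closure k (rat_eval k F ` (X - indet k F))"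

subsection \<open>Basic Cremona maps\<close>

definition aut_map :: "nat \<Rightarrow> complex mat \<Rightarrow> rat_map" where
  "aut_map k A = rat_class k (\<lambda>v. A *\<^sub>v v)"

text \<open>$[1/x_0 : \ldots : 1/x_k]$, multiplied through by $x_0 \cdots x_k$.\<close>

definition J_map :: "nat \<Rightarrow> rat_map" where
  "J_map k = rat_class k (\<lambda>v. vec (k + 1) (\<lambda>i. \<Prod>j\<in>{0..k} - {i}. v $ j))"

definition basic_cremona :: "nat \<Rightarrow> complex mat \<Rightarrow> complex mat \<Rightarrow> rat_map \<Rightarrow> bool" where
  "basic_cremona k S T F \<longleftrightarrow> S \<in> lin_auts k \<and> T \<in> lin_auts k \<and> birational_map k F \<and>
     F = rat_comp k (aut_map k S) (rat_comp k (J_map k) (aut_map k (the (mat_inverse T))))"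

subsection \<open>The cuspidal curve\<close>

text \<open>The parameter \<open>None\<close> stands for infinity.\<close>

fun gam :: "nat \<Rightarrow> complex option \<Rightarrow> complex vec set" where
  "gam k (Some t) = proj_pt (vec (k + 1) (\<lambda>i. if i < k then t ^ i else t ^ (k + 1)))"
| "gam k None = proj_pt (unit_vec (k + 1) k)"

definition C_reg :: "nat \<Rightarrow> complex vec set set" where
  "C_reg k = range (\<lambda>t. gam k (Some t))"

definition curve :: "nat \<Rightarrow> complex vec set set" where
  "curve k = range (gam k)"

text \<open>Morphisms from a subvariety X to $P^k$ are the maps that near each point of X are given
  by a tuple of homogeneous polynomials without common zero. The neighbourhood can always be
  taken to be the locus in X where the tuple does not vanish: multiply the tuple by a form that
  vanishes off the given neighbourhood but not at the point.\<close>

definition regular_on ::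
    "nat \<Rightarrow> complex vec set set \<Rightarrow> (complex vec set \<Rightarrow> complex vec set) \<Rightarrow> bool" where
  "regular_on k X \<phi> \<longleftrightarrow>
     (\<forall>p\<in>X. \<exists>d f. hom_poly_map k d f \<and> (\<forall>v\<in>p. f v \<noteq> 0\<^sub>v (k + 1)) \<and>
        (\<forall>q\<in>X. \<forall>v\<in>q. f v \<noteq> 0\<^sub>v (k + 1) \<longrightarrow> \<phi> q = proj_pt (f v)))"

definition variety_aut ::
    "nat \<Rightarrow> complex vec set set \<Rightarrow> (complex vec set \<Rightarrow> complex vec set) \<Rightarrow> bool" where
  "variety_aut k X \<phi> \<longleftrightarrow>
     bij_betw \<phi> X X \<and> regular_on k X \<phi> \<and> regular_on k X (inv_into X \<phi>)"

text \<open>The pair (S, T) is not unique, but the set of the points $T(e_j)$ depends only on F.\<close>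

definition centered_on_curve :: "nat \<Rightarrow> rat_map \<Rightarrow> bool" where
  "centered_on_curve k F \<longleftrightarrow>
     (\<exists>S T. basic_cremona k S T F \<and> (\<forall>j\<le>k. apply_aut T (coord_pt k j) \<in> C_reg k))"

definition properly_fixes_curve :: "nat \<Rightarrow> rat_map \<Rightarrow> bool" where
  "properly_fixes_curve k F \<longleftrightarrow>
     centered_on_curve k F \<and> proper_transform k F (curve k) = curve k"

text \<open>The map induced on the curve is the automorphism of the curve that agrees with F wherever
  F is defined. F itself is undefined at the points $T(e_j)$ of the curve.\<close>

definition induced_aut ::
    "nat \<Rightarrow> rat_map \<Rightarrow> (complex vec set \<Rightarrow> complex vec set) \<Rightarrow> bool" where
  "induced_aut k F \<phi> \<longleftrightarrow> variety_aut k (curve k) \<phi> \<and>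
     (\<forall>p\<in>curve k - indet k F. \<phi> p = rat_eval k F p)"

text \<open>F properly fixes the curve and restricts to $\gamma(t) \mapsto \gamma(\delta t + \tau)$;
  \<open>map_option\<close> makes infinity a fixed point of the parameter change.\<close>

definition properly_fixes_by :: "nat \<Rightarrow> rat_map \<Rightarrow> complex \<Rightarrow> complex \<Rightarrow> bool" where
  "properly_fixes_by k F \<delta> \<tau> \<longleftrightarrow> properly_fixes_curve k F \<and>
     (\<exists>\<phi>. induced_aut k F \<phi> \<and>
          (\<forall>t. \<phi> (gam k t) = gam k (map_option (\<lambda>s. \<delta> * s + \<tau>) t)))"

end

theory Submission
  imports Defs "Jordan_Normal_Form.Determinant" "HOL-Computational_Algebra.Polynomial"
begin

text \<open>Write $g(t) = (1, t, \ldots, t^{k-1}, t^{k+1})$ and $\sigma = \sum_j t_j^+$. If $T$ has the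
  columns $g(t_j^+)$, then the $i$-th coordinate of $T^{-1} g(t)$ is a polynomial of degree $k+1$ without
  term $t^k$ that vanishes at all $t_j^+$ with $j \neq i$; so its roots sum to 0, and the remaining
  root is $t_i^+ - \sigma$. After applying $J$ and cancelling a common factor, the coordinates
  are multiples of $(t - t_i^+) \prod_{j \neq i} (t - t_j^+ + \sigma)$. With
  $u = \delta t + \tau$ and $\tau$ as claimed, these are, up to constants, the coordinates of
  $T'^{-1} g(u)$ for the matrix $T'$ with columns $g(\delta t_j^+ - 2\tau/(k-1))$. So $T'$
  with suitably scaled columns is a solution $S$. For any other $S$, comparing the two solutions gives
  an invertible matrix that maps $g(u)$ to a multiple of $g(u + \varepsilon)$ for infinitely
  many u; comparing degrees and the coefficients of $u^k$ shows that $\varepsilon = 0$ and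
  that the matrix is scalar.\<close>

subsection \<open>Homogeneous polynomial functions\<close>

text \<open>A hyperplane cuts the finite part of the curve in the zeros of a polynomial of degree at
  most k + 1 without term t^k. So k + 1 distinct parameters give linearly dependent points exactly
  when they sum to 0, which is where \<sigma> \<noteq> 0 enters. The same condition yields \<tau>:
  after J and the cancellation, the i-th coordinate has, in the parameter u, the roots \<delta> t_i
  + \<tau> and \<delta> (t_j - \<sigma>) + \<tau> for j \<noteq> i. These must again sum to 0, that
  is, \<delta> \<sigma> - k \<delta> \<sigma> + (k + 1) \<tau> = 0. The root \<delta> (t_j -
  \<sigma>) + \<tau>, which occurs in every coordinate but the j-th, is then the parameter of
  S(e_j). The obstacle is that the explicit tuple vanishes at the points \<gamma>(t_j), while a
  rational map is a class of tuples that may vanish at different points. Values at \<gamma>(t) are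
  therefore compared off finitely many parameters and extended by identities between polynomials in
  t; the cusp is treated directly.\<close>

lemma hom_poly_cmult: "hom_poly n d p \<Longrightarrow> hom_poly n d (\<lambda>v. c * p v)"
  using hom_poly.mult[OF hom_poly.const] by fastforce

lemma hom_poly_diff:
  assumes "hom_poly n d p" "hom_poly n d q"
  shows "hom_poly n d (\<lambda>v. p v - q v)"
  using hom_poly.add[OF assms(1) hom_poly_cmult[OF assms(2), of "-1"]] by simp

lemma hom_poly_power: "hom_poly n d p \<Longrightarrow> hom_poly n (m * d) (\<lambda>v. p v ^ m)"
proof (induction m)
  case 0
  then show ?case using hom_poly.const[of n 1] by simp
next
  case (Suc m)
  then show ?case using hom_poly.mult[of n d p "m * d" "\<lambda>v. p v ^ m"] by simp
qed

lemma hom_poly_coord_power: "i < n \<Longrightarrow> hom_poly n m (\<lambda>v. v $ i ^ m)"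
  using hom_poly_power[OF hom_poly.coord, of i n m] by simp

lemma hom_poly_zero:
  assumes "0 < n"
  shows "hom_poly n d (\<lambda>v. 0)"
  using hom_poly_cmult[OF hom_poly_coord_power[OF assms], of d 0] by simp

lemma hom_poly_sum:
  assumes "0 < n" and "\<And>i. i \<in> I \<Longrightarrow> hom_poly n d (p i)"
  shows "hom_poly n d (\<lambda>v. \<Sum>i\<in>I. p i v)"
  using assms(2)
proof (induction I rule: infinite_finite_induct)
  case (insert i I)
  then show ?case using hom_poly.add[of n d "p i" "\<lambda>v. \<Sum>i\<in>I. p i v"] by simp
qed (simp_all add: hom_poly_zero assms(1))

lemma hom_poly_prod:
  assumes "finite I" and "\<And>i. i \<in> I \<Longrightarrow> hom_poly n d (p i)"
  shows "hom_poly n (card I * d) (\<lambda>v. \<Prod>i\<in>I. p i v)"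
  using assms
proof (induction I rule: finite_induct)
  case empty
  then show ?case using hom_poly.const[of n 1] by simp
next
  case (insert i I)
  then show ?case using hom_poly.mult[of n d "p i" "card I * d" "\<lambda>v. \<Prod>i\<in>I. p i v"] by simp
qed

lemma hom_poly_smult:
  "hom_poly n d p \<Longrightarrow> v \<in> carrier_vec n \<Longrightarrow> p (c \<cdot>\<^sub>v v) = c ^ d * p v"
  by (induction rule: hom_poly.induct) (auto simp: algebra_simps power_add)

lemma hom_poly_compose:
  assumes "hom_poly n d p" and "\<And>i. i < n \<Longrightarrow> hom_poly m e (q i)"
  shows "hom_poly m (d * e) (\<lambda>v. p (vec n (\<lambda>i. q i v)))"
  using assms(1)
proof (induction rule: hom_poly.induct)
  case (const c)
  then show ?case using hom_poly.const by simp
next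
  case (coord i)
  then show ?case using assms(2) by simp
next
  case (add d p q)
  then show ?case using hom_poly.add by blast
next
  case (mult d p e' q)
  then show ?case unfolding add_mult_distrib using hom_poly.mult by blast
qed

text \<open>Reduces vanishing questions about forms to polynomials in one variable, which have
  finitely many roots or are zero. It is applied to lines and to the two charts of the cuspidal
  curve.\<close>

lemma hom_poly_along_poly_curve:
  assumes "hom_poly n d p"
  shows "\<exists>R. \<forall>t. p (vec n (\<lambda>i. poly (c i) t)) = poly R t"
  using assms
proof (induction rule: hom_poly.induct)
  case (const c)
  show ?case by (rule exI[of _ "[:c:]"]) simp
next
  case (coord i)
  then show ?case by (auto intro!: exI[of _ "c i"])
next
  case (add d p q)
  then obtain P Q where "\<forall>t. p (vec n (\<lambda>i. poly (c i) t)) = poly P t"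
    "\<forall>t. q (vec n (\<lambda>i. poly (c i) t)) = poly Q t" by blast
  then show ?case by (intro exI[of _ "P + Q"]) simp
next
  case (mult d p e q)
  then obtain P Q where "\<forall>t. p (vec n (\<lambda>i. poly (c i) t)) = poly P t"
    "\<forall>t. q (vec n (\<lambda>i. poly (c i) t)) = poly Q t" by blast
  then show ?case by (intro exI[of _ "P * Q"]) simp
qed

text \<open>Both functions are polynomial along the line joining the two given points.\<close>

lemma hom_poly_mult_nonzero:
  assumes p: "hom_poly n d p" "v \<in> carrier_vec n" "p v \<noteq> 0"
    and q: "hom_poly n e q" "w \<in> carrier_vec n" "q w \<noteq> 0"
  shows "\<exists>u\<in>carrier_vec n. p u * q u \<noteq> 0"
proof -
  define l where "l t = vec n (\<lambda>i. poly [:v $ i, w $ i - v $ i:] t)" for t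
  obtain P Q where P: "\<forall>t. p (l t) = poly P t" and Q: "\<forall>t. q (l t) = poly Q t"
    using hom_poly_along_poly_curve[OF p(1)] hom_poly_along_poly_curve[OF q(1)]
    unfolding l_def by metis
  have "l 0 = v" "l 1 = w" using p(2) q(2) by (auto simp: l_def)
  then have "poly P 0 \<noteq> 0" "poly Q 1 \<noteq> 0" using P Q p(3) q(3) by metis+
  then have "P * Q \<noteq> 0" by auto
  then obtain t where "poly (P * Q) t \<noteq> 0" using poly_all_0_iff_0 by blast
  then show ?thesis using P Q by (intro bexI[of _ "l t"]) (auto simp: l_def)
qed

subsection \<open>Representatives of rational maps\<close>

text \<open>All 2 x 2 minors of the pair vanish. The zero vector is thus parallel to everything, so
  transitivity needs a nonzero vector in the middle.\<close>

definition par :: "nat \<Rightarrow> complex vec \<Rightarrow> complex vec \<Rightarrow> bool" where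
  "par k u v \<longleftrightarrow> (\<forall>i\<le>k. \<forall>j\<le>k. u $ i * v $ j = u $ j * v $ i)"

lemma rat_equiv_par:
  "rat_equiv k f g \<longleftrightarrow> rat_rep k f \<and> rat_rep k g \<and> (\<forall>v\<in>carrier_vec (k + 1). par k (f v) (g v))"
  by (simp add: rat_equiv_def par_def)

lemma par_sym: "par k u v \<Longrightarrow> par k v u"
  by (simp add: par_def mult.commute)

lemma nonzero_vec_index:
  assumes "v \<in> carrier_vec (k + 1)" "v \<noteq> 0\<^sub>v (k + 1)"
  obtains i where "i \<le> k" "v $ i \<noteq> 0"
  using assms by (metis Suc_eq_plus1 carrier_vecD eq_vecI index_zero_vec less_Suc_eq_le)

lemma par_smult:
  assumes "u \<in> carrier_vec (k + 1)" "v \<in> carrier_vec (k + 1)" "par k u v" "v \<noteq> 0\<^sub>v (k + 1)"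
  obtains c where "u = c \<cdot>\<^sub>v v"
proof -
  obtain j where j: "j \<le> k" "v $ j \<noteq> 0" using nonzero_vec_index[OF assms(2,4)] .
  have "u = (u $ j / v $ j) \<cdot>\<^sub>v v"
    using assms(1-3) j by (intro eq_vecI) (auto simp: par_def field_simps)
  then show ?thesis using that by blast
qed

lemma par_smult_left: "u \<in> carrier_vec (k + 1) \<Longrightarrow> par k u v \<Longrightarrow> par k (c \<cdot>\<^sub>v u) v"
  by (auto simp: par_def algebra_simps)

lemma par_smult_self: "v \<in> carrier_vec (k + 1) \<Longrightarrow> par k (c \<cdot>\<^sub>v v) v"
  by (auto simp: par_def)

lemma par_trans:
  assumes "u \<in> carrier_vec (k + 1)" "v \<in> carrier_vec (k + 1)" "w \<in> carrier_vec (k + 1)"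
    and "par k u v" "par k v w" "v \<noteq> 0\<^sub>v (k + 1)"
  shows "par k u w"
  using par_smult[OF assms(1,2,4,6)] par_smult_left[OF assms(2,5)] by metis

section \<open>Tuples of forms: homogeneity, composition, generic nonvanishing\<close>

lemma hom_poly_map_carrier:
  "hom_poly_map k d f \<Longrightarrow> v \<in> carrier_vec (k + 1) \<Longrightarrow> f v \<in> carrier_vec (k + 1)"
  by (auto simp: hom_poly_map_def)

lemma hom_poly_map_smult:
  assumes "hom_poly_map k d f" "v \<in> carrier_vec (k + 1)"
  shows "f (c \<cdot>\<^sub>v v) = c ^ d \<cdot>\<^sub>v f v"
proof -
  obtain p where p: "\<And>i. i \<le> k \<Longrightarrow> hom_poly (k + 1) d (p i)"
    "\<And>v. v \<in> carrier_vec (k + 1) \<Longrightarrow> f v = vec (k + 1) (\<lambda>i. p i v)"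
    using assms(1) unfolding hom_poly_map_def by auto
  then show ?thesis
    using assms(2) hom_poly_smult[OF p(1) assms(2)] by (intro eq_vecI) auto
qed

lemma hom_poly_map_compose:
  assumes "hom_poly_map k d f" "hom_poly_map k e g"
  shows "hom_poly_map k (d * e) (f \<circ> g)"
proof -
  obtain p where p: "\<And>i. i \<le> k \<Longrightarrow> hom_poly (k + 1) d (p i)"
    "\<And>v. v \<in> carrier_vec (k + 1) \<Longrightarrow> f v = vec (k + 1) (\<lambda>i. p i v)"
    using assms(1) unfolding hom_poly_map_def by auto
  obtain q where q: "\<And>i. i \<le> k \<Longrightarrow> hom_poly (k + 1) e (q i)"
    "\<And>v. v \<in> carrier_vec (k + 1) \<Longrightarrow> g v = vec (k + 1) (\<lambda>i. q i v)"
    using assms(2) unfolding hom_poly_map_def by auto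
  show ?thesis
    unfolding hom_poly_map_def
  proof (intro exI conjI allI impI ballI)
    show "hom_poly (k + 1) (d * e) (\<lambda>v. p i (vec (k + 1) (\<lambda>j. q j v)))" if "i \<le> k" for i
      by (rule hom_poly_compose[OF p(1)[OF that]]) (use q(1) in auto)
    show "(f \<circ> g) v = vec (k + 1) (\<lambda>i. p i (vec (k + 1) (\<lambda>j. q j v)))"
      if "v \<in> carrier_vec (k + 1)" for v
      using that by (auto simp: p(2) q(2))
  qed
qed

lemma rat_repE:
  assumes "rat_rep k f"
  obtains d where "hom_poly_map k d f"
  using assms by (auto simp: rat_rep_def)

lemma rat_rep_carrier: "rat_rep k f \<Longrightarrow> v \<in> carrier_vec (k + 1) \<Longrightarrow> f v \<in> carrier_vec (k + 1)"
  by (meson hom_poly_map_carrier rat_repE)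

lemma rat_rep_smult:
  assumes "rat_rep k f" "v \<in> carrier_vec (k + 1)" "f v \<noteq> 0\<^sub>v (k + 1)" "c \<noteq> 0"
  obtains b where "b \<noteq> 0" "f (c \<cdot>\<^sub>v v) = b \<cdot>\<^sub>v f v"
  using assms by (metis hom_poly_map_smult power_not_zero rat_repE)

text \<open>Supplies a form, namely a coordinate of f, whose nonvanishing certifies that f is
  nonzero; such forms cut out the hypersurfaces discarded in
  \<open>rat_equiv_generic\<close>.\<close>

lemma rat_rep_hom_poly:
  assumes "rat_rep k f"
  obtains d h i v where "hom_poly (k + 1) d h" "i \<le> k"
    "\<forall>v\<in>carrier_vec (k + 1). h v = f v $ i"
    "v \<in> carrier_vec (k + 1)" "h v \<noteq> 0"
proof -
  obtain d p where p: "\<And>i. i \<le> k \<Longrightarrow> hom_poly (k + 1) d (p i)"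
    "\<And>v. v \<in> carrier_vec (k + 1) \<Longrightarrow> f v = vec (k + 1) (\<lambda>i. p i v)"
    using assms unfolding rat_rep_def hom_poly_map_def by auto
  obtain v where v: "v \<in> carrier_vec (k + 1)" "f v \<noteq> 0\<^sub>v (k + 1)"
    using assms unfolding rat_rep_def by auto
  obtain i where "i \<le> k" "f v $ i \<noteq> 0"
    using nonzero_vec_index[OF rat_rep_carrier[OF assms v(1)] v(2)] .
  then show ?thesis using p v by (intro that[of d "p i" i v]) auto
qed

text \<open>The minors of f and g are forms. If one were nonzero somewhere, its product with h would
  be nonzero at some point, where f and g are parallel by assumption. So it suffices to compare f
  and g off a hypersurface.\<close>

lemma rat_equiv_generic:
  fixes w :: "complex vec"
  assumes f: "rat_rep k f" and g: "rat_rep k g"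
    and h: "hom_poly (k + 1) d h" "w \<in> carrier_vec (k + 1)" "h w \<noteq> 0"
    and par: "\<And>v :: complex vec. v \<in> carrier_vec (k + 1) \<Longrightarrow> h v \<noteq> 0 \<Longrightarrow> par k (f v) (g v)"
  shows "rat_equiv k f g"
  unfolding rat_equiv_par
proof (intro conjI ballI f g)
  fix v :: "complex vec" assume v: "v \<in> carrier_vec (k + 1)"
  obtain a p where p: "\<And>i. i \<le> k \<Longrightarrow> hom_poly (k + 1) a (p i)"
    "\<And>v. v \<in> carrier_vec (k + 1) \<Longrightarrow> f v = vec (k + 1) (\<lambda>i. p i v)"
    using f unfolding rat_rep_def hom_poly_map_def by auto
  obtain b q where q: "\<And>i. i \<le> k \<Longrightarrow> hom_poly (k + 1) b (q i)"
    "\<And>v. v \<in> carrier_vec (k + 1) \<Longrightarrow> g v = vec (k + 1) (\<lambda>i. q i v)"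
    using g unfolding rat_rep_def hom_poly_map_def by auto
  show "par k (f v) (g v)"
    unfolding par_def
  proof (intro allI impI, rule ccontr)
    fix i j assume ij: "i \<le> k" "j \<le> k" and ne: "f v $ i * g v $ j \<noteq> f v $ j * g v $ i"
    have "hom_poly (k + 1) (a + b) (\<lambda>v. p i v * q j v - p j v * q i v)"
      using ij p(1) q(1) by (intro hom_poly_diff hom_poly.mult)
    moreover have "p i v * q j v - p j v * q i v \<noteq> 0"
      using ne ij v by (simp add: p(2) q(2))
    ultimately obtain u where u: "u \<in> carrier_vec (k + 1)"
      "(p i u * q j u - p j u * q i u) * h u \<noteq> 0"
      using hom_poly_mult_nonzero[OF _ v _ h] by blast
    then show False using par[of u] ij by (auto simp: par_def p(2) q(2))
  qed
qed

section \<open>Equivalence and composition of representing tuples\<close>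

lemma rat_equiv_refl: "rat_rep k f \<Longrightarrow> rat_equiv k f f"
  by (simp add: rat_equiv_def mult.commute)

lemma rat_equiv_sym: "rat_equiv k f g \<Longrightarrow> rat_equiv k g f"
  by (simp add: rat_equiv_par par_sym)

text \<open>Pointwise transitivity breaks down where g vanishes, hence the comparison off the zero
  set of a coordinate of g.\<close>

lemma rat_equiv_trans:
  assumes "rat_equiv k f g" "rat_equiv k g h"
  shows "rat_equiv k f h"
proof -
  have rep: "rat_rep k f" "rat_rep k g" "rat_rep k h" using assms by (auto simp: rat_equiv_def)
  obtain d q i w where q: "hom_poly (k + 1) d q" "i \<le> k"
    "\<forall>v\<in>carrier_vec (k + 1). q v = g v $ i" "w \<in> carrier_vec (k + 1)" "q w \<noteq> 0"
    using rat_rep_hom_poly[OF rep(2)] .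
  show ?thesis
  proof (rule rat_equiv_generic[OF rep(1,3) q(1,4,5)])
    fix v :: "complex vec" assume v: "v \<in> carrier_vec (k + 1)" "q v \<noteq> 0"
    then have "g v \<noteq> 0\<^sub>v (k + 1)" using q by auto
    then show "par k (f v) (h v)"
      using par_trans[OF rep[THEN rat_rep_carrier, OF v(1)]] assms v by (auto simp: rat_equiv_par)
  qed
qed

lemma rat_class_eq: "rat_equiv k f g \<Longrightarrow> rat_class k f = rat_class k g"
  unfolding rat_class_def using rat_equiv_sym rat_equiv_trans by blast

lemma rat_class_self: "rat_rep k f \<Longrightarrow> f \<in> rat_class k f"
  by (simp add: rat_class_def rat_equiv_refl)

text \<open>Composition does not depend on the representatives: off the zeros of one coordinate of g
  and one of g', the two inner values are nonzero multiples of each other, and homogeneity of f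
  turns this into a multiple of the outer value.\<close>

lemma rat_comp_class:
  assumes f: "rat_rep k f" and g: "rat_rep k g" and fg: "rat_rep k (f \<circ> g)"
  shows "rat_comp k (rat_class k f) (rat_class k g) = rat_class k (f \<circ> g)"
proof
  show "rat_class k (f \<circ> g) \<subseteq> rat_comp k (rat_class k f) (rat_class k g)"
    using f g by (auto simp: rat_comp_def rat_class_def dest: rat_equiv_refl)
next
  show "rat_comp k (rat_class k f) (rat_class k g) \<subseteq> rat_class k (f \<circ> g)"
  proof
    fix h assume "h \<in> rat_comp k (rat_class k f) (rat_class k g)"
    then obtain f' g' where f': "rat_equiv k f f'" and g': "rat_equiv k g g'"
      and h: "rat_equiv k (f' \<circ> g') h"
      by (auto simp: rat_comp_def rat_class_def)
    have rep: "rat_rep k f'" "rat_rep k g'" "rat_rep k (f' \<circ> g')"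
      using f' g' h by (auto simp: rat_equiv_def)
    obtain d p i v where p: "hom_poly (k + 1) d p" "i \<le> k"
      "\<forall>v\<in>carrier_vec (k + 1). p v = g v $ i" "v \<in> carrier_vec (k + 1)" "p v \<noteq> 0"
      using rat_rep_hom_poly[OF g] .
    obtain e q j w where q: "hom_poly (k + 1) e q" "j \<le> k"
      "\<forall>v\<in>carrier_vec (k + 1). q v = g' v $ j" "w \<in> carrier_vec (k + 1)" "q w \<noteq> 0"
      using rat_rep_hom_poly[OF rep(2)] .
    obtain a where a: "hom_poly_map k a f" using f by (rule rat_repE)
    obtain u where u: "u \<in> carrier_vec (k + 1)" "p u * q u \<noteq> 0"
      using hom_poly_mult_nonzero[OF p(1,4,5) q(1,4,5)] by auto
    have "rat_equiv k (f \<circ> g) (f' \<circ> g')"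
    proof (rule rat_equiv_generic[OF fg rep(3) hom_poly.mult[OF p(1) q(1)] u])
      fix v :: "complex vec" assume v: "v \<in> carrier_vec (k + 1)" and "p v * q v \<noteq> 0"
      then have nz: "g v \<noteq> 0\<^sub>v (k + 1)" "g' v \<noteq> 0\<^sub>v (k + 1)" using p q by auto
      have c: "g v \<in> carrier_vec (k + 1)" "g' v \<in> carrier_vec (k + 1)"
        using rat_rep_carrier[OF g v] rat_rep_carrier[OF rep(2) v] by auto
      obtain b where b: "g v = b \<cdot>\<^sub>v g' v"
        using par_smult[OF c _ nz(2)] g' v by (auto simp: rat_equiv_par)
      have "par k (f (g' v)) (f' (g' v))" using f' c by (auto simp: rat_equiv_par)
      then show "par k ((f \<circ> g) v) ((f' \<circ> g') v)"
        using par_smult_left[OF rat_rep_carrier[OF f c(2)]] by (simp add: b hom_poly_map_smult[OF a c(2)])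
    qed
    then show "h \<in> rat_class k (f \<circ> g)"
      using h rat_equiv_trans by (auto simp: rat_class_def)
  qed
qed

subsection \<open>Evaluation of rational maps\<close>

lemma proj_pt_self: "v \<in> proj_pt v"
  by (auto simp: proj_pt_def intro: exI[of _ 1])

lemma proj_pt_smult:
  assumes "c \<noteq> 0"
  shows "proj_pt (c \<cdot>\<^sub>v v) = proj_pt v"
proof -
  have "proj_pt (a \<cdot>\<^sub>v w) \<subseteq> proj_pt w" if "a \<noteq> 0" for a w
  proof
    fix x assume "x \<in> proj_pt (a \<cdot>\<^sub>v w)"
    then obtain b where "b \<noteq> 0" "x = b \<cdot>\<^sub>v (a \<cdot>\<^sub>v w)" unfolding proj_pt_def by auto
    then have "b * a \<noteq> 0" "x = (b * a) \<cdot>\<^sub>v w" using that by (simp_all add: smult_smult_assoc)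
    then show "x \<in> proj_pt w" unfolding proj_pt_def by blast
  qed
  from this[OF assms, of v] this[of "1 / c" "c \<cdot>\<^sub>v v"] show ?thesis
    using assms by (simp add: smult_smult_assoc)
qed

lemma proj_pt_eqD: "proj_pt v = proj_pt w \<Longrightarrow> \<exists>c. c \<noteq> 0 \<and> v = c \<cdot>\<^sub>v w"
  using proj_pt_self[of v] by (auto simp: proj_pt_def)

lemma proj_pt_par:
  assumes "u \<in> carrier_vec (k + 1)" "v \<in> carrier_vec (k + 1)" "par k u v"
    and "u \<noteq> 0\<^sub>v (k + 1)" "v \<noteq> 0\<^sub>v (k + 1)"
  shows "proj_pt u = proj_pt v"
proof -
  obtain c where c: "u = c \<cdot>\<^sub>v v" using par_smult[OF assms(1-3,5)] .
  then have "c \<noteq> 0" using assms(2,4) by auto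
  then show ?thesis by (simp add: c proj_pt_smult)
qed

text \<open>The description behind \<open>THE\<close> is unique because all representatives that do
  not vanish at a point have parallel nonzero values there.\<close>

lemma rat_eval_class:
  assumes f: "rat_rep k f" and v: "v \<in> carrier_vec (k + 1)" "f v \<noteq> 0\<^sub>v (k + 1)"
  shows "rat_eval k (rat_class k f) (proj_pt v) = proj_pt (f v)"
  unfolding rat_eval_def
proof (rule the_equality)
  show "\<exists>g\<in>rat_class k f. \<exists>w\<in>proj_pt v. g w \<noteq> 0\<^sub>v (k + 1) \<and> proj_pt (f v) = proj_pt (g w)"
    using rat_class_self[OF f] proj_pt_self v by blast
next
  fix q assume "\<exists>g\<in>rat_class k f. \<exists>w\<in>proj_pt v. g w \<noteq> 0\<^sub>v (k + 1) \<and> q = proj_pt (g w)"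
  then obtain g c where g: "rat_equiv k f g" and c: "c \<noteq> 0" "g (c \<cdot>\<^sub>v v) \<noteq> 0\<^sub>v (k + 1)"
    and q: "q = proj_pt (g (c \<cdot>\<^sub>v v))"
    by (auto simp: rat_class_def proj_pt_def)
  obtain b where b: "b \<noteq> 0" "f (c \<cdot>\<^sub>v v) = b \<cdot>\<^sub>v f v"
    using rat_rep_smult[OF f v c(1)] .
  have "par k (g (c \<cdot>\<^sub>v v)) (f (c \<cdot>\<^sub>v v))" "rat_rep k g"
    using g v by (auto simp: rat_equiv_par par_sym)
  moreover from calculation(2) have "g (c \<cdot>\<^sub>v v) \<in> carrier_vec (k + 1)"
    "f (c \<cdot>\<^sub>v v) \<in> carrier_vec (k + 1)"
    using v(1) f by (metis rat_rep_carrier smult_carrier_vec)+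
  moreover have "f (c \<cdot>\<^sub>v v) \<noteq> 0\<^sub>v (k + 1)"
    using b v(2) rat_rep_carrier[OF f v(1)] by (auto simp: vec_eq_iff)
  ultimately have "q = proj_pt (f (c \<cdot>\<^sub>v v))"
    unfolding q using c(2) by (intro proj_pt_par[of _ k])
  then show "q = proj_pt (f v)" using b by (simp add: proj_pt_smult)
qed

subsection \<open>Basic Cremona maps in coordinates\<close>

definition Jv :: "nat \<Rightarrow> complex vec \<Rightarrow> complex vec" where
  "Jv k v = vec (k + 1) (\<lambda>i. \<Prod>j\<in>{0..k} - {i}. v $ j)"

text \<open>The argument \<open>B\<close> stands for the inverse of T, not for T itself.\<close>

definition cremona :: "nat \<Rightarrow> complex mat \<Rightarrow> complex mat \<Rightarrow> complex vec \<Rightarrow> complex vec" where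
  "cremona k S B v = S *\<^sub>v Jv k (B *\<^sub>v v)"

text \<open>The inverse is kept explicit because for \<open>Gam\<close> it is the concrete
  interpolation matrix \<open>Lag\<close>, with which all computations are done.\<close>

definition inv_pair :: "nat \<Rightarrow> complex mat \<Rightarrow> complex mat \<Rightarrow> bool" where
  "inv_pair k A B \<longleftrightarrow> A \<in> carrier_mat (k + 1) (k + 1) \<and> B \<in> carrier_mat (k + 1) (k + 1) \<and>
     A * B = 1\<^sub>m (k + 1) \<and> B * A = 1\<^sub>m (k + 1)"

lemma inv_pairI:
  assumes "A \<in> carrier_mat (k + 1) (k + 1)" "B \<in> carrier_mat (k + 1) (k + 1)"
    and "A * B = 1\<^sub>m (k + 1)"
  shows "inv_pair k A B"
  using assms mat_mult_left_right_inverse[OF assms] by (simp add: inv_pair_def)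

lemma inv_pair_sym: "inv_pair k A B \<Longrightarrow> inv_pair k B A"
  by (simp add: inv_pair_def)

lemma inv_pair_cancel:
  assumes "inv_pair k A B" "v \<in> carrier_vec (k + 1)"
  shows "A *\<^sub>v (B *\<^sub>v v) = v"
proof -
  have "A *\<^sub>v (B *\<^sub>v v) = (A * B) *\<^sub>v v"
    using assms by (intro assoc_mult_mat_vec[symmetric, of _ "k + 1" "k + 1"]) (auto simp: inv_pair_def)
  then show ?thesis using assms by (simp add: inv_pair_def)
qed

lemma inv_pair_unique:
  assumes "inv_pair k A B" "inv_pair k A C"
  shows "B = C"
proof -
  have "B = (C * A) * B" using assms by (auto simp: inv_pair_def)
  also have "\<dots> = C * (A * B)" using assms by (intro assoc_mult_mat) (auto simp: inv_pair_def)
  also have "\<dots> = C" using assms by (auto simp: inv_pair_def)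
  finally show ?thesis .
qed

lemma inv_pair_mult:
  assumes A: "inv_pair k A B" and C: "inv_pair k C D"
  shows "inv_pair k (A * C) (D * B)"
proof (rule inv_pairI)
  have cA: "A \<in> carrier_mat (k + 1) (k + 1)" "B \<in> carrier_mat (k + 1) (k + 1)"
    and cC: "C \<in> carrier_mat (k + 1) (k + 1)" "D \<in> carrier_mat (k + 1) (k + 1)"
    using A C by (auto simp: inv_pair_def)
  then show "A * C \<in> carrier_mat (k + 1) (k + 1)" "D * B \<in> carrier_mat (k + 1) (k + 1)"
    by simp_all
  have "A * C * (D * B) = A * (C * (D * B))"
    by (rule assoc_mult_mat[OF cA(1) cC(1) mult_carrier_mat[OF cC(2) cA(2)]])
  also have "C * (D * B) = (C * D) * B" by (rule assoc_mult_mat[OF cC cA(2), symmetric])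
  also have "C * D = 1\<^sub>m (k + 1)" using C by (simp add: inv_pair_def)
  also have "1\<^sub>m (k + 1) * B = B" using cA(2) by (rule left_mult_one_mat)
  also have "A * B = 1\<^sub>m (k + 1)" using A by (simp add: inv_pair_def)
  finally show "A * C * (D * B) = 1\<^sub>m (k + 1)" .
qed

lemma inv_pair_diag:
  assumes "\<And>i. i \<le> k \<Longrightarrow> a i \<noteq> 0"
  shows "inv_pair k (mat_diag (k + 1) a) (mat_diag (k + 1) (\<lambda>i. inverse (a i)))"
proof (rule inv_pairI)
  have "mat_diag (k + 1) (\<lambda>i. a i * inverse (a i)) = mat_diag (k + 1) (\<lambda>i. 1)"
    unfolding mat_diag_def using assms by (intro cong_mat) auto
  then show "mat_diag (k + 1) a * mat_diag (k + 1) (\<lambda>i. inverse (a i)) = 1\<^sub>m (k + 1)" by simp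
qed simp_all

lemma lin_auts_inv_pair: "A \<in> lin_auts k \<longleftrightarrow> (\<exists>B. inv_pair k A B)"
proof
  assume A: "A \<in> lin_auts k"
  then obtain B where B: "A * B = 1\<^sub>m (dim_row A)" "B * A = 1\<^sub>m (dim_row B)"
    by (auto simp: lin_auts_def invertible_mat_def inverts_mat_def)
  have "dim_row B = dim_col A" "dim_col B = dim_row A"
    using B by (metis index_mult_mat(3) index_one_mat(3))+
  then show "\<exists>B. inv_pair k A B"
    using A B by (intro exI[of _ B] inv_pairI) (auto simp: lin_auts_def)
next
  assume "\<exists>B. inv_pair k A B"
  then show "A \<in> lin_auts k"
    by (auto simp: lin_auts_def invertible_mat_def inverts_mat_def inv_pair_def)
qed

text \<open>Being a unit of the matrix ring rules out the result \<open>None\<close> of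
  \<open>mat_inverse\<close>; the rest is uniqueness of inverses.\<close>

lemma the_mat_inverse:
  assumes "inv_pair k A B"
  shows "the (mat_inverse A) = B"
proof -
  have A: "A \<in> carrier_mat (k + 1) (k + 1)" using assms by (simp add: inv_pair_def)
  have "A \<in> Units (ring_mat TYPE(complex) (k + 1) ())"
    using assms by (auto simp: inv_pair_def Units_def ring_mat_def)
  then obtain C where C: "mat_inverse A = Some C"
    using mat_inverse(1)[OF A, of "()"] by (cases "mat_inverse A") auto
  then have "inv_pair k A C" using mat_inverse(2)[OF A C] A by (simp add: inv_pair_def)
  then show ?thesis using inv_pair_unique[OF assms] C by simp
qed

text \<open>Count occurrences: for l \<noteq> i the factor \<open>w l\<close> appears once for every
  j other than i and l, so m times, while \<open>w i\<close> appears for every j \<noteq> i, so m +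
  1 times. This gives both the common factor in J o J and the one that cancels on the curve.\<close>

lemma prod_prod_remove:
  fixes w :: "'a \<Rightarrow> 'b :: comm_semiring_1"
  assumes A: "finite A" and i: "i \<in> A" and card: "card A = Suc (Suc m)"
  shows "(\<Prod>j\<in>A - {i}. \<Prod>l\<in>A - {j}. w l) = (\<Prod>l\<in>A. w l) ^ m * w i"
proof -
  define B where "B = A - {i}"
  have B: "finite B" "card B = Suc m" "i \<notin> B" "A = insert i B"
    using assms by (auto simp: B_def card_Diff_singleton)
  have "(\<Prod>j\<in>B. \<Prod>l\<in>B - {j}. w l) = (\<Prod>j\<in>B. \<Prod>l | l \<in> B \<and> j \<noteq> l. w l)"
    by (intro prod.cong) auto
  also have "\<dots> = (\<Prod>l\<in>B. \<Prod>j | j \<in> B \<and> j \<noteq> l. w l)"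
    by (rule prod.swap_restrict) (use B in auto)
  also have "\<dots> = (\<Prod>l\<in>B. w l ^ m)"
  proof (intro prod.cong refl)
    fix l assume "l \<in> B"
    moreover have "{j. j \<in> B \<and> j \<noteq> l} = B - {l}" by auto
    ultimately show "(\<Prod>j | j \<in> B \<and> j \<noteq> l. w l) = w l ^ m" using B by (simp add: card_Diff_singleton)
  qed
  also have "\<dots> = (\<Prod>l\<in>B. w l) ^ m" by (simp add: prod_power_distrib)
  finally have *: "(\<Prod>j\<in>B. \<Prod>l\<in>B - {j}. w l) = (\<Prod>l\<in>B. w l) ^ m" .
  have "(\<Prod>j\<in>B. \<Prod>l\<in>A - {j}. w l) = (\<Prod>j\<in>B. w i * (\<Prod>l\<in>B - {j}. w l))"
  proof (intro prod.cong refl)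
    fix j assume "j \<in> B"
    then have "A - {j} = insert i (B - {j})" using B by auto
    then show "(\<Prod>l\<in>A - {j}. w l) = w i * (\<Prod>l\<in>B - {j}. w l)" using B by simp
  qed
  also have "\<dots> = (w i * (\<Prod>l\<in>B. w l)) ^ m * w i"
    using B by (simp add: prod.distrib * power_mult_distrib algebra_simps)
  finally show ?thesis using B by (simp add: B_def[symmetric])
qed

section \<open>The involution J and nonvanishing of Cremona tuples\<close>

lemma Jv_carrier [simp]: "Jv k v \<in> carrier_vec (k + 1)"
  by (simp add: Jv_def)

lemma Jv_Jv:
  assumes "k \<ge> 1" "w \<in> carrier_vec (k + 1)"
  shows "Jv k (Jv k w) = (\<Prod>l\<in>{0..k}. w $ l) ^ (k - 1) \<cdot>\<^sub>v w"
proof (rule eq_vecI)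
  fix i assume "i < dim_vec ((\<Prod>l\<in>{0..k}. w $ l) ^ (k - 1) \<cdot>\<^sub>v w)"
  then have i: "i \<le> k" using assms by auto
  have "Jv k (Jv k w) $ i = (\<Prod>j\<in>{0..k} - {i}. \<Prod>l\<in>{0..k} - {j}. w $ l)"
    using i unfolding Jv_def by (auto intro!: prod.cong)
  also have "\<dots> = (\<Prod>l\<in>{0..k}. w $ l) ^ (k - 1) * w $ i"
    by (rule prod_prod_remove) (use assms i in auto)
  finally show "Jv k (Jv k w) $ i = ((\<Prod>l\<in>{0..k}. w $ l) ^ (k - 1) \<cdot>\<^sub>v w) $ i"
    using i assms by simp
qed (use assms in \<open>simp add: Jv_def\<close>)

lemma hom_poly_map_Jv: "hom_poly_map k k (Jv k)"
  unfolding hom_poly_map_def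
proof (intro exI conjI allI impI ballI)
  fix i assume "i \<le> k"
  then show "hom_poly (k + 1) k (\<lambda>v. \<Prod>j\<in>{0..k} - {i}. v $ j)"
    using hom_poly_prod[of "{0..k} - {i}" "k + 1" 1 "\<lambda>j v. v $ j"] hom_poly.coord[of _ "k + 1"]
    by (auto simp: card_Diff_singleton)
qed (simp add: Jv_def)

lemma hom_poly_map_mat:
  assumes "A \<in> carrier_mat (k + 1) (k + 1)"
  shows "hom_poly_map k 1 (\<lambda>v. A *\<^sub>v v)"
  unfolding hom_poly_map_def
proof (intro exI conjI allI impI ballI)
  show "hom_poly (k + 1) 1 (\<lambda>v. \<Sum>j\<in>{0..<k + 1}. A $$ (i, j) * v $ j)" for i
    by (intro hom_poly_sum hom_poly_cmult hom_poly.coord) auto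
  show "A *\<^sub>v v = vec (k + 1) (\<lambda>i. \<Sum>j\<in>{0..<k + 1}. A $$ (i, j) * v $ j)"
    if "v \<in> carrier_vec (k + 1)" for v
    using assms that by (intro eq_vecI) (auto simp: scalar_prod_def)
qed

lemma cremona_eq_comp: "cremona k S B = (\<lambda>v. S *\<^sub>v v) \<circ> (Jv k \<circ> (\<lambda>v. B *\<^sub>v v))"
  by (auto simp: cremona_def)

lemma hom_poly_map_cremona:
  assumes "S \<in> carrier_mat (k + 1) (k + 1)" "B \<in> carrier_mat (k + 1) (k + 1)"
  shows "hom_poly_map k k (cremona k S B)"
  using hom_poly_map_compose[OF hom_poly_map_mat[OF assms(1)]
      hom_poly_map_compose[OF hom_poly_map_Jv hom_poly_map_mat[OF assms(2)]]]
  by (simp add: cremona_eq_comp)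

lemma inv_pair_nonzero:
  assumes "inv_pair k A B" "v \<in> carrier_vec (k + 1)" "v \<noteq> 0\<^sub>v (k + 1)"
  shows "A *\<^sub>v v \<noteq> 0\<^sub>v (k + 1)"
proof
  assume "A *\<^sub>v v = 0\<^sub>v (k + 1)"
  then have "B *\<^sub>v (A *\<^sub>v v) = 0\<^sub>v (k + 1)" using assms(1) by (auto simp: inv_pair_def)
  then show False using inv_pair_cancel[OF inv_pair_sym[OF assms(1)] assms(2)] assms(3) by simp
qed

lemma cremona_carrier: "S \<in> carrier_mat (k + 1) (k + 1) \<Longrightarrow> cremona k S B v \<in> carrier_vec (k + 1)"
  unfolding cremona_def by (rule mult_mat_vec_carrier[OF _ Jv_carrier])

lemma cremona_nonzero:
  assumes S: "inv_pair k S Si" and B: "B \<in> carrier_mat (k + 1) (k + 1)" and v: "v \<in> carrier_vec (k + 1)"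
    and ne: "\<And>i. i \<le> k \<Longrightarrow> (B *\<^sub>v v) $ i \<noteq> 0"
  shows "cremona k S B v \<noteq> 0\<^sub>v (k + 1)"
proof -
  have "Jv k (B *\<^sub>v v) $ 0 \<noteq> 0" using ne by (simp add: Jv_def)
  then show ?thesis unfolding cremona_def
    by (intro inv_pair_nonzero[OF S Jv_carrier]) auto
qed

text \<open>A test vector without zero coordinates, fixed by \<open>Jv\<close>; it and its images
  under matrices witness that tuples do not vanish identically.\<close>

definition ones :: "nat \<Rightarrow> complex vec" where
  "ones k = vec (k + 1) (\<lambda>i. 1)"

lemma ones_carrier: "ones k \<in> carrier_vec (k + 1)"
  by (simp add: ones_def)

lemma ones_index: "i \<le> k \<Longrightarrow> ones k $ i = 1"
  by (simp add: ones_def)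

lemma ones_nonzero: "ones k \<noteq> 0\<^sub>v (k + 1)"
proof -
  have "ones k $ 0 \<noteq> 0\<^sub>v (k + 1) $ 0" by (simp add: ones_index)
  then show ?thesis by fastforce
qed

lemma rat_rep_mat:
  assumes "inv_pair k A B"
  shows "rat_rep k (\<lambda>v. A *\<^sub>v v)"
  unfolding rat_rep_def
proof (intro conjI exI bexI)
  show "hom_poly_map k 1 (\<lambda>v. A *\<^sub>v v)" using assms by (intro hom_poly_map_mat) (simp add: inv_pair_def)
  show "A *\<^sub>v ones k \<noteq> 0\<^sub>v (k + 1)" by (rule inv_pair_nonzero[OF assms ones_carrier ones_nonzero])
qed (rule ones_carrier)

lemma rat_rep_cremona:
  assumes S: "inv_pair k S Si" and B: "inv_pair k B Bi"
  shows "rat_rep k (cremona k S B)"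
proof -
  have c: "S \<in> carrier_mat (k + 1) (k + 1)" "B \<in> carrier_mat (k + 1) (k + 1)"
    "Bi \<in> carrier_mat (k + 1) (k + 1)"
    using S B by (auto simp: inv_pair_def)
  have v: "Bi *\<^sub>v ones k \<in> carrier_vec (k + 1)" by (rule mult_mat_vec_carrier[OF _ ones_carrier]) (use c in simp)
  have "cremona k S B (Bi *\<^sub>v ones k) \<noteq> 0\<^sub>v (k + 1)"
    by (rule cremona_nonzero[OF S c(2) v])
      (simp add: inv_pair_cancel[OF B ones_carrier] ones_index)
  then show ?thesis using hom_poly_map_cremona[OF c(1,2)] v unfolding rat_rep_def by blast
qed

lemma inv_pair_one: "inv_pair k (1\<^sub>m (k + 1)) (1\<^sub>m (k + 1))"
  by (intro inv_pairI) auto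

lemma rat_rep_hom_cong:
  assumes "rat_rep k f" "\<And>v. v \<in> carrier_vec (k + 1) \<Longrightarrow> g v = f v"
  shows "rat_rep k g"
  using assms by (auto simp: rat_rep_def hom_poly_map_def)

section \<open>Composition and inversion of Cremona maps\<close>

lemma cremona_class:
  assumes S: "inv_pair k S Si" and B: "inv_pair k B Bi"
  shows "rat_comp k (aut_map k S) (rat_comp k (J_map k) (aut_map k B)) = rat_class k (cremona k S B)"
proof -
  have one: "1\<^sub>m (k + 1) *\<^sub>v Jv k w = Jv k w" for w
    by (rule one_mult_mat_vec[OF Jv_carrier])
  have J: "rat_rep k (Jv k)"
    \<comment> \<open>J itself is the Cremona tuple with both matrices equal to the
      identity.\<close>
    by (rule rat_rep_hom_cong[OF rat_rep_cremona[OF inv_pair_one inv_pair_one]])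
      (simp only: cremona_def one one_mult_mat_vec)
  have JB: "rat_rep k (Jv k \<circ> (\<lambda>v. B *\<^sub>v v))"
    by (rule rat_rep_hom_cong[OF rat_rep_cremona[OF inv_pair_one B]])
      (simp only: cremona_def one comp_def)
  have "J_map k = rat_class k (Jv k)"
    unfolding J_map_def Jv_def ..
  then have "rat_comp k (J_map k) (aut_map k B) = rat_class k (Jv k \<circ> (\<lambda>v. B *\<^sub>v v))"
    unfolding aut_map_def using rat_comp_class[OF J rat_rep_mat[OF B] JB] by simp
  then show ?thesis
    unfolding aut_map_def
    using rat_comp_class[OF rat_rep_mat[OF S] JB] rat_rep_cremona[OF S B] by (simp add: cremona_eq_comp)
qed

text \<open>The inverse of S J T^(-1) is T J S^(-1): the inner matrices cancel, and J o J is the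
  identity times a form. Exchanging S and T gives the other composition.\<close>

lemma cremona_inverse:
  assumes k: "k \<ge> 1" and S: "inv_pair k S Si" and T: "inv_pair k T Ti"
  shows "rat_comp k (rat_class k (cremona k S Ti)) (rat_class k (cremona k T Si)) = rat_class k (\<lambda>v. v)"
proof -
  have c: "S \<in> carrier_mat (k + 1) (k + 1)" "T \<in> carrier_mat (k + 1) (k + 1)"
    "Si \<in> carrier_mat (k + 1) (k + 1)" "Ti \<in> carrier_mat (k + 1) (k + 1)"
    using S T by (auto simp: inv_pair_def)
  have eq: "(cremona k S Ti \<circ> cremona k T Si) v = (\<Prod>l\<in>{0..k}. (Si *\<^sub>v v) $ l) ^ (k - 1) \<cdot>\<^sub>v v"
    if v: "v \<in> carrier_vec (k + 1)" for v
  proof -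
    have Sv: "Si *\<^sub>v v \<in> carrier_vec (k + 1)" using c(3) v by (rule mult_mat_vec_carrier)
    have "(cremona k S Ti \<circ> cremona k T Si) v = S *\<^sub>v (Jv k (Jv k (Si *\<^sub>v v)))"
      by (simp add: cremona_def inv_pair_cancel[OF inv_pair_sym[OF T] Jv_carrier])
    also have "\<dots> = (\<Prod>l\<in>{0..k}. (Si *\<^sub>v v) $ l) ^ (k - 1) \<cdot>\<^sub>v (S *\<^sub>v (Si *\<^sub>v v))"
      using mult_mat_vec[OF c(1) Sv] by (simp add: Jv_Jv[OF k Sv])
    finally show ?thesis by (simp add: inv_pair_cancel[OF S v])
  qed
  have id: "rat_rep k (\<lambda>v. v)"
    by (rule rat_rep_hom_cong[OF rat_rep_mat[OF inv_pair_one]]) (rule one_mult_mat_vec[symmetric])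
  have "rat_rep k (cremona k S Ti \<circ> cremona k T Si)"
    unfolding rat_rep_def
  proof (intro conjI bexI exI)
    show "hom_poly_map k (k * k) (cremona k S Ti \<circ> cremona k T Si)"
      by (intro hom_poly_map_compose hom_poly_map_cremona c)
    \<comment> \<open>\<open>Si\<close> sends this point to \<open>ones k\<close>, so the scalar
      form in \<open>eq\<close> takes the value 1 there.\<close>
    show v: "S *\<^sub>v ones k \<in> carrier_vec (k + 1)" by (rule mult_mat_vec_carrier[OF _ ones_carrier]) (use c in simp)
    show "(cremona k S Ti \<circ> cremona k T Si) (S *\<^sub>v ones k) \<noteq> 0\<^sub>v (k + 1)"
      unfolding eq[OF v] inv_pair_cancel[OF inv_pair_sym[OF S] ones_carrier]
      using inv_pair_nonzero[OF S ones_carrier ones_nonzero] by (simp add: ones_index)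
  qed
  moreover from this have "rat_equiv k (cremona k S Ti \<circ> cremona k T Si) (\<lambda>v. v)"
    unfolding rat_equiv_par using id eq par_smult_self by auto
  ultimately show ?thesis
    using rat_comp_class[OF rat_rep_cremona[OF S inv_pair_sym[OF T]]
        rat_rep_cremona[OF T inv_pair_sym[OF S]]] rat_class_eq by metis
qed

lemma basic_cremona_class:
  assumes "k \<ge> 1" and S: "inv_pair k S Si" and T: "inv_pair k T Ti"
  shows "basic_cremona k S T (rat_class k (cremona k S Ti))"
  unfolding basic_cremona_def birational_map_def
proof (intro conjI bexI)
  show "S \<in> lin_auts k" "T \<in> lin_auts k" using S T by (auto simp: lin_auts_inv_pair)
  show "rat_class k (cremona k S Ti) \<in> rat_maps k" "rat_class k (cremona k T Si) \<in> rat_maps k"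
    unfolding rat_maps_def using rat_rep_cremona S T inv_pair_sym by blast+
  show "rat_class k (cremona k S Ti) =
      rat_comp k (aut_map k S) (rat_comp k (J_map k) (aut_map k (the (mat_inverse T))))"
    unfolding the_mat_inverse[OF T] cremona_class[OF S inv_pair_sym[OF T]] ..
qed (intro cremona_inverse assms)+

lemma basic_cremonaE:
  assumes "basic_cremona k S T F"
  obtains Si Ti where "inv_pair k S Si" "inv_pair k T Ti" "F = rat_class k (cremona k S Ti)"
proof -
  obtain Si Ti where p: "inv_pair k S Si" "inv_pair k T Ti"
    using assms by (auto simp: basic_cremona_def lin_auts_inv_pair)
  then show ?thesis
    using that[OF p] assms cremona_class[OF p(1) inv_pair_sym[OF p(2)]] the_mat_inverse[OF p(2)]
    by (simp add: basic_cremona_def)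
qed

subsection \<open>Interpolation on the cuspidal curve\<close>

definition cusp_exp :: "nat \<Rightarrow> nat \<Rightarrow> nat" where
  "cusp_exp k i = (if i < k then i else k + 1)"

definition gamv :: "nat \<Rightarrow> complex \<Rightarrow> complex vec" where
  "gamv k t = vec (k + 1) (\<lambda>i. t ^ cusp_exp k i)"

lemma gamv_carrier [simp]: "gamv k t \<in> carrier_vec (k + 1)"
  by (simp add: gamv_def)

lemma dim_gamv [simp]: "dim_vec (gamv k t) = Suc k"
  by (simp add: gamv_def)

lemma gamv_index: "i \<le> k \<Longrightarrow> gamv k t $ i = t ^ cusp_exp k i"
  by (simp add: gamv_def)

lemma gamv_0: "k \<ge> 1 \<Longrightarrow> gamv k t $ 0 = 1"
  by (simp add: gamv_def cusp_exp_def)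

lemma gamv_nonzero: "k \<ge> 1 \<Longrightarrow> gamv k t \<noteq> 0\<^sub>v (k + 1)"
  using gamv_0[of k t] by fastforce

lemma gam_Some: "gam k (Some t) = proj_pt (gamv k t)"
proof -
  have "vec (k + 1) (\<lambda>i. if i < k then t ^ i else t ^ (k + 1)) = gamv k t"
    by (intro eq_vecI) (auto simp: gamv_def cusp_exp_def)
  then show ?thesis by simp
qed

text \<open>A linear factor shifts the coefficients and subtracts y times the old ones. The shift
  \<open>pCons 0\<close> addresses the coefficient just below the top one, so that no truncated
  \<open>card A - 1\<close> arises for empty A.\<close>

lemma coeff_linear_prod:
  fixes y :: "'a \<Rightarrow> 'b :: comm_ring_1"
  assumes "finite A"
  shows "(\<forall>n>card A. coeff (\<Prod>j\<in>A. [:- y j, 1:]) n = 0) \<and>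
    coeff (\<Prod>j\<in>A. [:- y j, 1:]) (card A) = 1 \<and>
    coeff (pCons 0 (\<Prod>j\<in>A. [:- y j, 1:])) (card A) = - (\<Sum>j\<in>A. y j)"
  using assms
proof (induction A rule: finite_induct)
  case empty
  then show ?case by (auto simp: coeff_pCons split: nat.split)
next
  case (insert x A)
  define P where "P = (\<Prod>j\<in>A. [:- y j, 1:])"
  have "(\<Prod>j\<in>insert x A. [:- y j, 1:]) = smult (- y x) P + pCons 0 P"
    using insert by (simp add: P_def)
  moreover have "\<forall>n>card A. coeff P n = 0" "coeff P (card A) = 1"
    "coeff (pCons 0 P) (card A) = - (\<Sum>j\<in>A. y j)"
    using insert by (auto simp: P_def)
  ultimately show ?case using insert by (auto simp: coeff_pCons split: nat.splits)
qed

section \<open>Lagrange polynomials adapted to the curve and their coefficient matrix\<close>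

definition asum :: "nat \<Rightarrow> (nat \<Rightarrow> complex) \<Rightarrow> complex" where
  "asum k a = (\<Sum>j\<in>{0..k}. a j)"

text \<open>Normalizes \<open>lag_poly k a i\<close> to the value 1 at \<open>a i\<close>, where the
  factor belonging to the additional root \<open>a i - asum k a\<close> equals
  \<open>asum k a\<close>.\<close>

definition lag_coeff :: "nat \<Rightarrow> (nat \<Rightarrow> complex) \<Rightarrow> nat \<Rightarrow> complex" where
  "lag_coeff k a i = inverse (asum k a * (\<Prod>j\<in>{0..k} - {i}. a i - a j))"

text \<open>The additional root makes the coefficient at $t^k$ vanish, so that these polynomials lie
  in the span of the coordinate functions of the parametrization.\<close>

definition lag_poly :: "nat \<Rightarrow> (nat \<Rightarrow> complex) \<Rightarrow> nat \<Rightarrow> complex poly" where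
  "lag_poly k a i =
     smult (lag_coeff k a i) (\<Prod>j\<in>{0..k}. [:- (a(i := a i - asum k a)) j, 1:])"

definition Gam :: "nat \<Rightarrow> (nat \<Rightarrow> complex) \<Rightarrow> complex mat" where
  "Gam k a = mat (k + 1) (k + 1) (\<lambda>(i, j). gamv k (a j) $ i)"

definition Lag :: "nat \<Rightarrow> (nat \<Rightarrow> complex) \<Rightarrow> complex mat" where
  "Lag k a = mat (k + 1) (k + 1) (\<lambda>(i, j). coeff (lag_poly k a i) (cusp_exp k j))"

lemma Gam_carrier [simp]: "Gam k a \<in> carrier_mat (k + 1) (k + 1)"
  by (simp add: Gam_def)

lemma Lag_carrier [simp]: "Lag k a \<in> carrier_mat (k + 1) (k + 1)"
  by (simp add: Lag_def)

lemma col_Gam: "j \<le> k \<Longrightarrow> col (Gam k a) j = gamv k (a j)"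
  by (intro eq_vecI) (auto simp: Gam_def gamv_def)

text \<open>Replacing the root \<open>a i\<close> by \<open>a i - asum k a\<close> lowers the sum of
  the k + 1 roots from \<open>asum k a\<close> to 0, and the coefficient of t^k is that sum times
  \<open>- lag_coeff k a i\<close>.\<close>

lemma coeff_lag_poly:
  assumes "i \<le> k"
  shows "n > k + 1 \<Longrightarrow> coeff (lag_poly k a i) n = 0"
    and "coeff (lag_poly k a i) (k + 1) = lag_coeff k a i"
    and "coeff (lag_poly k a i) k = 0"
proof -
  let ?y = "a(i := a i - asum k a)"
  have "(\<Sum>j\<in>{0..k}. ?y j) = ?y i + (\<Sum>j\<in>{0..k} - {i}. ?y j)"
    using assms by (intro sum.remove) auto
  also have "(\<Sum>j\<in>{0..k} - {i}. ?y j) = (\<Sum>j\<in>{0..k} - {i}. a j)"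
    by (intro sum.cong) auto
  also have "?y i + \<dots> = a i + (\<Sum>j\<in>{0..k} - {i}. a j) - asum k a" by simp
  also have "a i + (\<Sum>j\<in>{0..k} - {i}. a j) = asum k a"
    unfolding asum_def using assms by (intro sum.remove[symmetric]) auto
  finally have "(\<Sum>j\<in>{0..k}. ?y j) = 0" by simp
  with coeff_linear_prod[of "{0..k}" ?y]
  show "n > k + 1 \<Longrightarrow> coeff (lag_poly k a i) n = 0"
    and "coeff (lag_poly k a i) (k + 1) = lag_coeff k a i"
    and "coeff (lag_poly k a i) k = 0"
    unfolding lag_poly_def by (simp_all del: fun_upd_apply)
qed

lemma poly_lag_poly:
  assumes "i \<le> k"
  shows "poly (lag_poly k a i) t =
    lag_coeff k a i * (t - a i + asum k a) * (\<Prod>j\<in>{0..k} - {i}. t - a j)"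
proof -
  let ?y = "a(i := a i - asum k a)"
  have "(\<Prod>j\<in>{0..k}. t - ?y j) = (t - ?y i) * (\<Prod>j\<in>{0..k} - {i}. t - ?y j)"
    using assms by (intro prod.remove) auto
  also have "(\<Prod>j\<in>{0..k} - {i}. t - ?y j) = (\<Prod>j\<in>{0..k} - {i}. t - a j)"
    by (intro prod.cong) auto
  finally show ?thesis by (simp add: lag_poly_def poly_prod del: fun_upd_apply) (simp add: algebra_simps)
qed

lemma poly_cusp:
  fixes p :: "complex poly"
  assumes "\<And>n. n > k + 1 \<Longrightarrow> coeff p n = 0" "coeff p k = 0"
  shows "poly p t = (\<Sum>j\<in>{0..<k + 1}. coeff p (cusp_exp k j) * t ^ cusp_exp k j)"
proof -
  have "degree p \<le> k + 1" using assms(1) by (intro degree_le) auto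
  then have "poly p t = (\<Sum>n\<in>{..k + 1}. coeff p n * t ^ n)"
    unfolding poly_altdef by (intro sum.mono_neutral_left) (auto simp: coeff_eq_0)
  also have "{..k + 1} = insert (k + 1) (insert k {0..<k})" by auto
  also have "(\<Sum>n\<in>\<dots>. coeff p n * t ^ n) =
      coeff p (k + 1) * t ^ (k + 1) + (\<Sum>n\<in>{0..<k}. coeff p n * t ^ n)"
    using assms(2) by simp
  also have "\<dots> = (\<Sum>j\<in>{0..<k + 1}. coeff p (cusp_exp k j) * t ^ cusp_exp k j)"
    by (simp add: cusp_exp_def)
  finally show ?thesis .
qed

lemma Lag_gamv: "Lag k a *\<^sub>v gamv k t = vec (k + 1) (\<lambda>i. poly (lag_poly k a i) t)"
proof (rule eq_vecI)
  fix i assume "i < dim_vec (vec (k + 1) (\<lambda>i. poly (lag_poly k a i) t))"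
  then have i: "i \<le> k" by simp
  have "(Lag k a *\<^sub>v gamv k t) $ i =
      (\<Sum>j\<in>{0..<k + 1}. coeff (lag_poly k a i) (cusp_exp k j) * t ^ cusp_exp k j)"
    using i by (simp add: Lag_def gamv_def scalar_prod_def)
  also have "\<dots> = poly (lag_poly k a i) t"
    using coeff_lag_poly[OF i] by (intro poly_cusp[symmetric]) auto
  finally show "(Lag k a *\<^sub>v gamv k t) $ i = vec (k + 1) (\<lambda>i. poly (lag_poly k a i) t) $ i"
    using i by simp
qed (simp add: Lag_def)

text \<open>Lagrange interpolation: entry (i, j) of the product is the i-th polynomial evaluated at
  the j-th node. A nonzero sum keeps the additional root away from the node
  \<open>a i\<close>.\<close>

lemma inv_pair_Gam_Lag:
  assumes inj: "inj_on a {0..k}" and sum: "asum k a \<noteq> 0"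
  shows "inv_pair k (Gam k a) (Lag k a)"
proof (rule inv_pair_sym, rule inv_pairI)
  show "Lag k a * Gam k a = 1\<^sub>m (k + 1)"
  proof (rule eq_matI)
    fix i j assume "i < dim_row (1\<^sub>m (k + 1) :: complex mat)" "j < dim_col (1\<^sub>m (k + 1) :: complex mat)"
    then have ij: "i \<le> k" "j \<le> k" by auto
    have "(Lag k a * Gam k a) $$ (i, j) = (Lag k a *\<^sub>v gamv k (a j)) $ i"
      using ij col_Gam[OF ij(2), of a] by (simp add: Lag_def Gam_def)
    also have "\<dots> = poly (lag_poly k a i) (a j)" using ij by (simp add: Lag_gamv)
    also have "\<dots> = (if i = j then 1 else 0)"
    proof (cases "i = j")
      case True
      have "(\<Prod>l\<in>{0..k} - {i}. a i - a l) \<noteq> 0"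
        using inj ij by (auto simp: inj_on_def)
      then show ?thesis using True ij sum
        by (simp add: poly_lag_poly lag_coeff_def divide_inverse[symmetric] del: prod_zero_iff)
    next
      case False
      then have "(\<Prod>l\<in>{0..k} - {i}. a j - a l) = 0" using ij by (intro prod_zero) auto
      then show ?thesis using False ij by (simp add: poly_lag_poly)
    qed
    finally show "(Lag k a * Gam k a) $$ (i, j) = 1\<^sub>m (k + 1) $$ (i, j)" using ij by simp
  qed (simp_all add: Lag_def Gam_def)
qed (rule Lag_carrier Gam_carrier)+

lemma lag_coeff_nonzero:
  assumes "inj_on a {0..k}" "asum k a \<noteq> 0" "i \<le> k"
  shows "lag_coeff k a i \<noteq> 0"
  using assms by (auto simp: lag_coeff_def inj_on_def)

section \<open>The affine change of parameter\<close>

definition tshift :: "nat \<Rightarrow> complex \<Rightarrow> (nat \<Rightarrow> complex) \<Rightarrow> complex" where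
  "tshift k \<delta> a = (of_nat k - 1) / (of_nat k + 1) * \<delta> * asum k a"

text \<open>The image of the additional root \<open>a j - asum k a\<close> under the affine map;
  \<open>tpts_eq\<close> brings it into the form of the theorem.\<close>

definition tpts :: "nat \<Rightarrow> complex \<Rightarrow> (nat \<Rightarrow> complex) \<Rightarrow> nat \<Rightarrow> complex" where
  "tpts k \<delta> a j = \<delta> * (a j - asum k a) + tshift k \<delta> a"

text \<open>What remains of the i-th coordinate after J and the cancellation. Compared with
  \<open>lag_poly\<close> the two kinds of roots are exchanged: one node, and the additional roots
  of all other indices.\<close>

definition dual_lag :: "nat \<Rightarrow> (nat \<Rightarrow> complex) \<Rightarrow> nat \<Rightarrow> complex \<Rightarrow> complex" where
  "dual_lag k a i t = lag_coeff k a i * (t - a i) * (\<Prod>j\<in>{0..k} - {i}. t - a j + asum k a)"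

lemma of_nat_Suc_nonzero: "of_nat k + 1 \<noteq> (0 :: complex)"
  using of_nat_neq_0[of k, where 'a = complex] by (simp add: add.commute)

text \<open>The change of sign makes the exchange of roots consistent: the additional root for the
  new nodes, \<open>tpts k \<delta> a i\<close> minus their sum, is \<delta> \<open>a i\<close> +
  \<open>tshift k \<delta> a\<close>, the image of the old node.\<close>

lemma asum_tpts: "asum k (tpts k \<delta> a) = - \<delta> * asum k a"
proof -
  have "asum k (tpts k \<delta> a) = \<delta> * asum k a + (of_nat k + 1) * (tshift k \<delta> a - \<delta> * asum k a)"
    by (simp add: asum_def tpts_def sum.distrib sum_subtractf sum_distrib_left algebra_simps)
  also have "(of_nat k + 1) * tshift k \<delta> a = (of_nat k - 1) * \<delta> * asum k a"
    using of_nat_Suc_nonzero by (simp add: tshift_def)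
  then have "(of_nat k + 1) * (tshift k \<delta> a - \<delta> * asum k a) =
      (of_nat k - 1) * \<delta> * asum k a - (of_nat k + 1) * (\<delta> * asum k a)"
    by (simp add: right_diff_distrib)
  finally show ?thesis by (simp add: algebra_simps)
qed

lemma inj_on_tpts: "\<delta> \<noteq> 0 \<Longrightarrow> inj_on a A \<Longrightarrow> inj_on (tpts k \<delta> a) A"
  by (auto simp: inj_on_def tpts_def)

lemma tpts_eq:
  assumes "k \<ge> 2"
  shows "tpts k \<delta> a j = \<delta> * a j - 2 * tshift k \<delta> a / (of_nat k - 1)"
proof -
  have "of_nat k - 1 \<noteq> (0 :: complex)" using assms of_nat_eq_iff[of k 1, where 'a = complex] by simp
  then show ?thesis
    using of_nat_Suc_nonzero[of k] by (simp add: tpts_def tshift_def divide_simps) (simp add: algebra_simps)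
qed

lemma lag_coeff_tpts:
  assumes "i \<le> k"
  shows "lag_coeff k (tpts k \<delta> a) i = - inverse (\<delta> ^ (k + 1)) * lag_coeff k a i"
proof -
  have "(\<Prod>j\<in>{0..k} - {i}. tpts k \<delta> a i - tpts k \<delta> a j) = (\<Prod>j\<in>{0..k} - {i}. \<delta> * (a i - a j))"
    by (intro prod.cong) (auto simp: tpts_def algebra_simps)
  also have "\<dots> = \<delta> ^ k * (\<Prod>j\<in>{0..k} - {i}. a i - a j)"
    using assms by (simp add: prod.distrib)
  finally show ?thesis by (simp add: lag_coeff_def asum_tpts)
qed

lemma lag_poly_tpts:
  assumes "i \<le> k" "\<delta> \<noteq> 0"
  shows "poly (lag_poly k (tpts k \<delta> a) i) (\<delta> * t + tshift k \<delta> a) = - dual_lag k a i t"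
proof -
  have "(\<Prod>j\<in>{0..k} - {i}. \<delta> * t + tshift k \<delta> a - tpts k \<delta> a j) =
      (\<Prod>j\<in>{0..k} - {i}. \<delta> * (t - a j + asum k a))"
    by (intro prod.cong) (auto simp: tpts_def algebra_simps)
  also have "\<dots> = \<delta> ^ k * (\<Prod>j\<in>{0..k} - {i}. t - a j + asum k a)"
    using assms by (simp add: prod.distrib)
  finally have 1: "(\<Prod>j\<in>{0..k} - {i}. \<delta> * t + tshift k \<delta> a - tpts k \<delta> a j) =
      \<delta> ^ k * (\<Prod>j\<in>{0..k} - {i}. t - a j + asum k a)" .
  have 2: "\<delta> * t + tshift k \<delta> a - tpts k \<delta> a i + asum k (tpts k \<delta> a) = \<delta> * (t - a i)"
    by (simp add: asum_tpts) (simp add: tpts_def algebra_simps)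
  show ?thesis
    unfolding poly_lag_poly[OF assms(1)] 1 2 lag_coeff_tpts[OF assms(1)] dual_lag_def
    using assms(2) by (simp add: field_simps)
qed

text \<open>J leaves in coordinate i the leading coefficients of all other indices, whereas
  \<open>dual_lag\<close> carries the one of index i. Multiplying by its square completes the
  product and makes the factor on the right independent of i.\<close>

lemma Jv_Lag_gamv:
  assumes "k \<ge> 1" and inj: "inj_on a {0..k}" "asum k a \<noteq> 0" and i: "i \<le> k"
  shows "Jv k (Lag k a *\<^sub>v gamv k t) $ i * lag_coeff k a i ^ 2 =
    (\<Prod>j\<in>{0..k}. t - a j) ^ (k - 1) * (\<Prod>j\<in>{0..k}. lag_coeff k a j) * dual_lag k a i t"
proof -
  let ?A = "{0..k} - {i}"
  have "Jv k (Lag k a *\<^sub>v gamv k t) $ i =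
      (\<Prod>j\<in>?A. lag_coeff k a j * (t - a j + asum k a) * (\<Prod>l\<in>{0..k} - {j}. t - a l))"
    using i unfolding Jv_def Lag_gamv by (auto simp: poly_lag_poly intro!: prod.cong)
  also have "\<dots> = (\<Prod>j\<in>?A. lag_coeff k a j) * (\<Prod>j\<in>?A. t - a j + asum k a) *
      ((\<Prod>j\<in>{0..k}. t - a j) ^ (k - 1) * (t - a i))"
    using prod_prod_remove[of "{0..k}" i "k - 1" "\<lambda>l. t - a l"] assms(1) i
    by (simp add: prod.distrib)
  finally have J: "Jv k (Lag k a *\<^sub>v gamv k t) $ i =
    (\<Prod>j\<in>?A. lag_coeff k a j) * (\<Prod>j\<in>?A. t - a j + asum k a) *
      ((\<Prod>j\<in>{0..k}. t - a j) ^ (k - 1) * (t - a i))" .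
  have c: "(\<Prod>j\<in>{0..k}. lag_coeff k a j) = lag_coeff k a i * (\<Prod>j\<in>?A. lag_coeff k a j)"
    using i by (intro prod.remove) auto
  show ?thesis unfolding J c dual_lag_def by (simp add: power2_eq_square algebra_simps)
qed

section \<open>The explicit matrix S and its action on the curve\<close>

lemma mat_diag_mult_vec:
  assumes "v \<in> carrier_vec n"
  shows "mat_diag n f *\<^sub>v v = vec n (\<lambda>i. f i * v $ i)"
proof (rule eq_vecI)
  fix i assume i: "i < dim_vec (vec n (\<lambda>i. f i * v $ i))"
  have "(mat_diag n f *\<^sub>v v) $ i = (\<Sum>j\<in>{0..<n}. if i = j then f j * v $ j else 0)"
    using assms i by (auto simp: mat_diag_def scalar_prod_def if_distrib[of "\<lambda>x. x * _"] cong: if_cong)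
  also have "\<dots> = f i * v $ i" using i by simp
  finally show "(mat_diag n f *\<^sub>v v) $ i = vec n (\<lambda>i. f i * v $ i) $ i" using i by simp
qed (simp add: mat_diag_def)

text \<open>The squares in the diagonal factor are those of \<open>Jv_Lag_gamv\<close>; they scale
  the columns so that all coordinates get the same scalar.\<close>

definition Smat :: "nat \<Rightarrow> complex \<Rightarrow> (nat \<Rightarrow> complex) \<Rightarrow> complex mat" where
  "Smat k \<delta> a = Gam k (tpts k \<delta> a) * mat_diag (k + 1) (\<lambda>i. lag_coeff k a i ^ 2)"

lemma inv_pair_Smat:
  assumes "\<delta> \<noteq> 0" "inj_on a {0..k}" "asum k a \<noteq> 0"
  shows "inv_pair k (Smat k \<delta> a)
    (mat_diag (k + 1) (\<lambda>i. inverse (lag_coeff k a i ^ 2)) * Lag k (tpts k \<delta> a))"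
  unfolding Smat_def
  using assms lag_coeff_nonzero[OF assms(2,3)]
  by (intro inv_pair_mult inv_pair_Gam_Lag inv_pair_diag inj_on_tpts) (auto simp: asum_tpts)

lemma diag_Jv_Lag_gamv:
  assumes "k \<ge> 1" "\<delta> \<noteq> 0" "inj_on a {0..k}" "asum k a \<noteq> 0"
  shows "mat_diag (k + 1) (\<lambda>i. lag_coeff k a i ^ 2) *\<^sub>v Jv k (Lag k a *\<^sub>v gamv k t) =
    - ((\<Prod>j\<in>{0..k}. t - a j) ^ (k - 1) * (\<Prod>j\<in>{0..k}. lag_coeff k a j)) \<cdot>\<^sub>v
      (Lag k (tpts k \<delta> a) *\<^sub>v gamv k (\<delta> * t + tshift k \<delta> a))"
  unfolding mat_diag_mult_vec[OF Jv_carrier] Lag_gamv[of _ "tpts k \<delta> a"]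
  by (intro eq_vecI)
    (use Jv_Lag_gamv[OF assms(1,3,4), of _ t] lag_poly_tpts[OF _ assms(2), of _ k a t]
      in \<open>auto simp: mult.commute[of "_ ^ 2"]\<close>)

lemma cremona_Smat_gamv:
  assumes "k \<ge> 1" "\<delta> \<noteq> 0" "inj_on a {0..k}" "asum k a \<noteq> 0"
  shows "cremona k (Smat k \<delta> a) (Lag k a) (gamv k t) =
    - ((\<Prod>j\<in>{0..k}. t - a j) ^ (k - 1) * (\<Prod>j\<in>{0..k}. lag_coeff k a j)) \<cdot>\<^sub>v
      gamv k (\<delta> * t + tshift k \<delta> a)"
proof -
  let ?D = "mat_diag (k + 1) (\<lambda>i. lag_coeff k a i ^ 2)" and ?b = "tpts k \<delta> a"
  have b: "inv_pair k (Gam k ?b) (Lag k ?b)"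
    using assms by (intro inv_pair_Gam_Lag inj_on_tpts) (auto simp: asum_tpts)
  have "cremona k (Smat k \<delta> a) (Lag k a) (gamv k t) =
      Gam k ?b *\<^sub>v (?D *\<^sub>v Jv k (Lag k a *\<^sub>v gamv k t))"
    unfolding cremona_def Smat_def
    by (rule assoc_mult_mat_vec[OF Gam_carrier mat_diag_dim Jv_carrier])
  also have "\<dots> = - ((\<Prod>j\<in>{0..k}. t - a j) ^ (k - 1) * (\<Prod>j\<in>{0..k}. lag_coeff k a j)) \<cdot>\<^sub>v
      (Gam k ?b *\<^sub>v (Lag k ?b *\<^sub>v gamv k (\<delta> * t + tshift k \<delta> a)))"
    unfolding diag_Jv_Lag_gamv[OF assms]
    by (rule mult_mat_vec[OF Gam_carrier mult_mat_vec_carrier[OF Lag_carrier gamv_carrier]])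
  finally show ?thesis by (simp only: inv_pair_cancel[OF b gamv_carrier])
qed

lemma Lag_unit_vec: "Lag k a *\<^sub>v unit_vec (k + 1) k = vec (k + 1) (\<lambda>i. lag_coeff k a i)"
proof (rule eq_vecI)
  fix i assume "i < dim_vec (vec (k + 1) (\<lambda>i. lag_coeff k a i))"
  then have i: "i \<le> k" by simp
  have "(Lag k a *\<^sub>v unit_vec (k + 1) k) $ i = Lag k a $$ (i, k)"
    using i Lag_carrier[of k a] by simp
  then show "(Lag k a *\<^sub>v unit_vec (k + 1) k) $ i = vec (k + 1) (\<lambda>i. lag_coeff k a i) $ i"
    using i coeff_lag_poly(2)[OF i] by (simp add: Lag_def cusp_exp_def)
qed (simp add: Lag_def)

text \<open>At the cusp the Lagrange polynomials are replaced by their leading coefficients. As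
  these are nonzero, so is the scalar: the tuple is defined at the cusp without any
  cancellation.\<close>

lemma cremona_Smat_cusp:
  assumes "\<delta> \<noteq> 0" "inj_on a {0..k}" "asum k a \<noteq> 0"
  shows "cremona k (Smat k \<delta> a) (Lag k a) (unit_vec (k + 1) k) =
    - (\<delta> ^ (k + 1) * (\<Prod>j\<in>{0..k}. lag_coeff k a j)) \<cdot>\<^sub>v unit_vec (k + 1) k"
proof -
  let ?D = "mat_diag (k + 1) (\<lambda>i. lag_coeff k a i ^ 2)" and ?b = "tpts k \<delta> a"
  have b: "inv_pair k (Gam k ?b) (Lag k ?b)"
    using assms by (intro inv_pair_Gam_Lag inj_on_tpts) (auto simp: asum_tpts)
  have e: "unit_vec (k + 1) k \<in> carrier_vec (k + 1)" by simp
  have "?D *\<^sub>v Jv k (Lag k a *\<^sub>v unit_vec (k + 1) k) =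
      - (\<delta> ^ (k + 1) * (\<Prod>j\<in>{0..k}. lag_coeff k a j)) \<cdot>\<^sub>v (Lag k ?b *\<^sub>v unit_vec (k + 1) k)"
    unfolding mat_diag_mult_vec[OF Jv_carrier] Lag_unit_vec
  proof (rule eq_vecI)
    fix i assume "i < dim_vec (- (\<delta> ^ (k + 1) * (\<Prod>j\<in>{0..k}. lag_coeff k a j)) \<cdot>\<^sub>v
      vec (k + 1) (\<lambda>i. lag_coeff k ?b i))"
    then have i: "i \<le> k" by simp
    have "(\<Prod>j\<in>{0..k}. lag_coeff k a j) = lag_coeff k a i * (\<Prod>j\<in>{0..k} - {i}. lag_coeff k a j)"
      using i by (intro prod.remove) auto
    moreover have "Jv k (vec (k + 1) (\<lambda>i. lag_coeff k a i)) $ i = (\<Prod>j\<in>{0..k} - {i}. lag_coeff k a j)"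
      using i by (auto simp: Jv_def intro!: prod.cong)
    ultimately show "vec (k + 1) (\<lambda>i. (lag_coeff k a i)\<^sup>2 *
          Jv k (vec (k + 1) (\<lambda>i. lag_coeff k a i)) $ i) $ i =
        (- (\<delta> ^ (k + 1) * (\<Prod>j\<in>{0..k}. lag_coeff k a j)) \<cdot>\<^sub>v vec (k + 1) (\<lambda>i. lag_coeff k ?b i)) $ i"
      using i assms(1) by (simp add: lag_coeff_tpts power2_eq_square del: power_Suc)
  qed simp
  moreover have "cremona k (Smat k \<delta> a) (Lag k a) (unit_vec (k + 1) k) =
      Gam k ?b *\<^sub>v (?D *\<^sub>v Jv k (Lag k a *\<^sub>v unit_vec (k + 1) k))"
    unfolding cremona_def Smat_def
    by (rule assoc_mult_mat_vec[OF Gam_carrier mat_diag_dim Jv_carrier])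
  ultimately have "cremona k (Smat k \<delta> a) (Lag k a) (unit_vec (k + 1) k) =
      - (\<delta> ^ (k + 1) * (\<Prod>j\<in>{0..k}. lag_coeff k a j)) \<cdot>\<^sub>v
        (Gam k ?b *\<^sub>v (Lag k ?b *\<^sub>v unit_vec (k + 1) k))"
    using mult_mat_vec[OF Gam_carrier mult_mat_vec_carrier[OF Lag_carrier e]] by simp
  then show ?thesis by (simp only: inv_pair_cancel[OF b e])
qed

section \<open>Rigidity of the curve under translations of the parameter\<close>

lemma poly_eq_if_infinite:
  fixes p q :: "'a :: idom poly"
  assumes "infinite U" "\<And>u. u \<in> U \<Longrightarrow> poly p u = poly q u"
  shows "p = q"
proof (rule ccontr)
  assume "p \<noteq> q"
  then have "finite {u. poly (p - q) u = 0}" by (intro poly_roots_finite) simp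
  moreover have "U \<subseteq> {u. poly (p - q) u = 0}" using assms(2) by auto
  ultimately show False using assms(1) finite_subset by blast
qed

lemma coeff_linear_power:
  "coeff ([:\<epsilon>, 1:] ^ (k + 1)) k = of_nat (k + 1) * (\<epsilon> :: 'a :: comm_ring_1)"
  using coeff_linear_prod[of "{0..k}" "\<lambda>_. - \<epsilon>"] by simp

lemma curve_translation_rigid:
  assumes k: "k \<ge> 1" and B: "inv_pair k B Bi" and U: "infinite U"
    and eq: "\<And>u. u \<in> U \<Longrightarrow> \<exists>l. B *\<^sub>v gamv k u = l \<cdot>\<^sub>v gamv k (u + \<epsilon>)"
  shows "\<epsilon> = 0 \<and> (\<exists>c. c \<noteq> 0 \<and> B = c \<cdot>\<^sub>m 1\<^sub>m (k + 1))"
proof -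
  have cB: "B \<in> carrier_mat (k + 1) (k + 1)" using B by (simp add: inv_pair_def)
  \<comment> \<open>Row i of B applied to g(u), read as a polynomial in u; its coefficients are the
    entries of the row, and the exponent k is missing.\<close>
  define b where "b i = (\<Sum>j\<in>{0..<k + 1}. monom (B $$ (i, j)) (cusp_exp k j))" for i
  have inj: "cusp_exp k i = cusp_exp k j \<longleftrightarrow> i = j" if "i \<le> k" "j \<le> k" for i j
    using that by (auto simp: cusp_exp_def split: if_splits)
  have coeff: "coeff (b i) (cusp_exp k j) = B $$ (i, j)" if "j \<le> k" for i j
  proof -
    have "coeff (b i) (cusp_exp k j) = (\<Sum>l\<in>{0..<k + 1}. if j = l then B $$ (i, l) else 0)"
      unfolding b_def coeff_sum using that inj by (intro sum.cong) auto
    also have "\<dots> = B $$ (i, j)" using that by simp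
    finally show ?thesis .
  qed
  have coeff_k: "coeff (b i) k = 0" for i
    unfolding b_def coeff_sum by (intro sum.neutral) (auto simp: cusp_exp_def)
  have coeff_gt: "coeff (b i) n = 0" if "n > k + 1" for i n
    unfolding b_def coeff_sum using that by (intro sum.neutral) (auto simp: cusp_exp_def)
  have poly_b: "poly (b i) u = (B *\<^sub>v gamv k u) $ i" if "i \<le> k" for i u
    using cB that by (simp add: b_def poly_sum poly_monom scalar_prod_def gamv_def)
  have b: "b i = b 0 * [:\<epsilon>, 1:] ^ cusp_exp k i" if i: "i \<le> k" for i
  proof (rule poly_eq_if_infinite[OF U])
    fix u assume "u \<in> U"
    then obtain l where l: "B *\<^sub>v gamv k u = l \<cdot>\<^sub>v gamv k (u + \<epsilon>)" using eq by blast
    \<comment> \<open>Coordinate 0 of \<open>gamv\<close> is 1, so the unknown scalar l is the value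
      of \<open>b 0\<close> at u and can be eliminated.\<close>
    have "poly (b j) u = l * (u + \<epsilon>) ^ cusp_exp k j" if "j \<le> k" for j
      using that by (simp add: poly_b[OF that] l gamv_index)
    from this[OF i] this[of 0] show "poly (b i) u = poly (b 0 * [:\<epsilon>, 1:] ^ cusp_exp k i) u"
      using k by (simp add: cusp_exp_def add.commute)
  qed
  have b0: "b 0 \<noteq> 0"
  proof
    assume "b 0 = 0"
    then have "B $$ (i, j) = 0" if "i \<le> k" "j \<le> k" for i j
      using b[OF that(1)] coeff[OF that(2), of i] by simp
    then have "B *\<^sub>v ones k = 0\<^sub>v (k + 1)"
      using cB by (intro eq_vecI) (auto simp: scalar_prod_def ones_def)
    then show False using inv_pair_nonzero[OF B ones_carrier ones_nonzero] by simp
  qed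
  have bk: "b k = b 0 * [:\<epsilon>, 1:] ^ (k + 1)" using b[of k] by (simp add: cusp_exp_def)
  \<comment> \<open>The factor (u + \<epsilon>)^(k + 1) uses up the whole degree available to row k,
    so \<open>b 0\<close> is constant.\<close>
  have "degree (b k) \<le> k + 1" using coeff_gt by (intro degree_le) auto
  moreover have "degree (b k) = degree (b 0) + (k + 1)"
    unfolding bk using b0 by (simp add: degree_mult_eq degree_power_eq del: power_Suc)
  ultimately have "degree (b 0) = 0" by simp
  then obtain c where c: "b 0 = [:c:]" by (rule degree_eq_zeroE)
  have c0: "c \<noteq> 0" using b0 c by simp
  \<comment> \<open>Row k has no term u^k, whereas c (u + \<epsilon>)^(k + 1) has the coefficient c
    (k + 1) \<epsilon> there.\<close>
  have "c * (of_nat (k + 1) * \<epsilon>) = 0"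
    using coeff_k[of k] unfolding bk c coeff_linear_power[symmetric] by simp
  then have \<epsilon>: "\<epsilon> = 0" using c0 of_nat_neq_0[of k, where 'a = complex] by simp
  have "b i = monom c (cusp_exp k i)" if "i \<le> k" for i
    using b[OF that] unfolding c \<epsilon> by (simp add: monom_altdef)
  then have "B $$ (i, j) = (if i = j then c else 0)" if "i \<le> k" "j \<le> k" for i j
    using coeff[OF that(2), of i] inj that by auto
  then have "B = c \<cdot>\<^sub>m 1\<^sub>m (k + 1)"
    using cB by (intro eq_matI) auto
  then show ?thesis using \<epsilon> c0 by blast
qed

subsection \<open>The cuspidal curve as a projective variety\<close>

lemma inj_gam:
  assumes "k \<ge> 2"
  shows "inj (gam k)"
proof (rule injI)
  have 1: "t = s" if eq: "gam k (Some t) = gam k (Some s)" for t s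
  proof -
    obtain c where c: "gamv k t = c \<cdot>\<^sub>v gamv k s" using proj_pt_eqD eq unfolding gam_Some by blast
    have "gamv k t $ i = c * gamv k s $ i" if "i \<le> k" for i using that by (simp add: c)
    from this[of 0] this[of 1] show "t = s" using assms by (simp add: gamv_index cusp_exp_def)
  qed
  have 2: "gam k (Some t) \<noteq> gam k None" for t
  proof
    assume "gam k (Some t) = gam k None"
    then obtain c where c: "gamv k t = c \<cdot>\<^sub>v unit_vec (k + 1) k"
      using proj_pt_eqD[of "gamv k t" "unit_vec (k + 1) k"] by (auto simp: gam_Some simp del: gam.simps(1))
    have "gamv k t $ 0 = 0" using assms by (simp add: c)
    then show False using gamv_0[of k t] assms by simp
  qed
  fix x y assume "gam k x = gam k y"
  then show "x = y" using 1 2 by (cases x; cases y) (simp_all del: gam.simps, metis+)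
qed

lemma curve_in_proj_space:
  assumes "k \<ge> 2"
  shows "curve k \<subseteq> proj_space k"
proof
  fix p assume "p \<in> curve k"
  then obtain t where t: "p = gam k t" by (auto simp: curve_def)
  show "p \<in> proj_space k"
  proof (cases t)
    case None
    then show ?thesis unfolding t by (auto simp: proj_space_def)
  next
    case (Some s)
    then show ?thesis
      unfolding t Some gam_Some proj_space_def using gamv_nonzero[of k s] assms
      by (intro imageI) (auto simp del: One_nat_def)
  qed
qed

text \<open>Where x_0 \<noteq> 0, \<open>e1\<close> and \<open>e2\<close> express all coordinates
  through t = x_1 / x_0. On the hyperplane x_0 = 0 these two only give x_1 = 0; there
  \<open>e3\<close> leaves nothing but the cusp.\<close>

lemma curve_equations:
  assumes k: "k \<ge> 2" and v: "v \<in> carrier_vec (k + 1)" "v \<noteq> 0\<^sub>v (k + 1)"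
    and e1: "\<And>i. 1 \<le> i \<Longrightarrow> i < k \<Longrightarrow> v $ 0 ^ (i - 1) * v $ i = v $ 1 ^ i"
    and e2: "v $ 0 ^ k * v $ k = v $ 1 ^ (k + 1)"
    and e3: "\<And>i. 1 \<le> i \<Longrightarrow> i < k \<Longrightarrow> v $ i ^ (k + 1) = v $ 0 ^ (k + 1 - i) * v $ k ^ i"
  shows "proj_pt v \<in> curve k"
proof (cases "v $ 0 = 0")
  case True
  have 0: "v $ i = 0" if "i < k" for i
  proof (cases "i = 0")
    case False
    then have "v $ i ^ (k + 1) = 0 ^ (k + 1 - i) * v $ k ^ i" using True e3[of i] that by simp
    also have "(0 :: complex) ^ (k + 1 - i) = 0" using that by (intro zero_power) simp
    finally show ?thesis by auto
  qed (simp add: True)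
  have "v = v $ k \<cdot>\<^sub>v unit_vec (k + 1) k"
    using v(1) 0 by (intro eq_vecI) (auto simp: less_Suc_eq)
  then have *: "proj_pt v = proj_pt (v $ k \<cdot>\<^sub>v unit_vec (k + 1) k)" by (rule arg_cong[where f = proj_pt])
  have "v $ k \<noteq> 0"
  proof
    assume "v $ k = 0"
    then have "v = 0\<^sub>v (k + 1)" using v(1) 0 by (intro eq_vecI) (auto simp: less_Suc_eq)
    then show False using v(2) by simp
  qed
  then have "proj_pt v = gam k None" unfolding * by (simp add: proj_pt_smult)
  then show ?thesis by (simp add: curve_def del: gam.simps)
next
  case False
  define t where "t = v $ 1 / v $ 0"
  have lt: "v $ 0 * t ^ i = v $ i" if "i < k" for i
  proof (cases i)
    case 0
    then show ?thesis by simp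
  next
    case (Suc j)
    then have "v $ 0 ^ j * v $ i = v $ 1 ^ i" using e1[of i] that by simp
    then show ?thesis using False Suc by (simp add: t_def field_simps)
  qed
  have eq: "v $ 0 * t ^ (k + 1) = v $ k"
    using e2 False by (simp add: t_def field_simps)
  have "v = v $ 0 \<cdot>\<^sub>v gamv k t"
    using v(1) lt eq by (intro eq_vecI) (auto simp: gamv_index cusp_exp_def less_Suc_eq)
  then have "proj_pt v = proj_pt (v $ 0 \<cdot>\<^sub>v gamv k t)" by (rule arg_cong[where f = proj_pt])
  also have "\<dots> = gam k (Some t)" unfolding gam_Some by (rule proj_pt_smult[OF False])
  finally have "proj_pt v = gam k (Some t)" .
  then show ?thesis by (simp add: curve_def del: gam.simps)
qed

lemma hom_poly_zero_on_curve:
  assumes h: "hom_poly (k + 1) d h" and k: "k \<ge> 1"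
    and U: "infinite U" "\<And>u. u \<in> U \<Longrightarrow> h (gamv k u) = 0"
  shows "h (gamv k t) = 0" and "h (unit_vec (k + 1) k) = 0"
proof -
  obtain R where "\<forall>t. h (vec (k + 1) (\<lambda>i. poly (monom 1 (cusp_exp k i)) t)) = poly R t"
    using hom_poly_along_poly_curve[OF h, of "\<lambda>i. monom 1 (cusp_exp k i)"] by blast
  then have R: "h (gamv k t) = poly R t" for t by (simp add: gamv_def poly_monom)
  have "R = 0" by (rule poly_eq_if_infinite[OF U(1)]) (simp add: R[symmetric] U(2))
  then show fin: "h (gamv k t) = 0" for t using R by simp
  \<comment> \<open>The chart at infinity: s^(k + 1) g(1/s) has polynomial coordinates, and s = 0
    gives the cusp. The form vanishes for s \<noteq> 0 by the first part, hence for s = 0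
    too.\<close>
  obtain Q where "\<forall>s. h (vec (k + 1) (\<lambda>i. poly (monom 1 (k + 1 - cusp_exp k i)) s)) = poly Q s"
    using hom_poly_along_poly_curve[OF h, of "\<lambda>i. monom 1 (k + 1 - cusp_exp k i)"] by blast
  then have Q: "h (vec (k + 1) (\<lambda>i. s ^ (k + 1 - cusp_exp k i))) = poly Q s" for s
    by (simp add: poly_monom)
  have "Q = 0"
  proof (rule poly_eq_if_infinite)
    show "infinite (UNIV - {0 :: complex})" by (simp add: infinite_UNIV_char_0)
    fix s :: complex assume "s \<in> UNIV - {0}"
    then have "vec (k + 1) (\<lambda>i. s ^ (k + 1 - cusp_exp k i)) = s ^ (k + 1) \<cdot>\<^sub>v gamv k (1 / s)"
      by (intro eq_vecI) (auto simp: gamv_index cusp_exp_def power_diff power_one_over field_simps)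
    then show "poly Q s = poly 0 s"
      using hom_poly_smult[OF h gamv_carrier] fin by (simp add: Q[symmetric])
  qed
  moreover have "vec (k + 1) (\<lambda>i. (0 :: complex) ^ (k + 1 - cusp_exp k i)) = unit_vec (k + 1) k"
    by (intro eq_vecI) (auto simp: cusp_exp_def)
  ultimately show "h (unit_vec (k + 1) k) = 0" using Q[of 0] by simp
qed

text \<open>A form that vanishes at infinitely many \<gamma>(u) vanishes on the whole curve, which
  gives one inclusion; the other holds because the curve is the zero set of the forms in
  \<open>curve_equations\<close>.\<close>

lemma zariski_closure_in_curve:
  assumes k: "k \<ge> 2" and X: "X \<subseteq> curve k" and inf: "infinite {u. gam k (Some u) \<in> X}"
  shows "zariski_closure k X = curve k"
proof
  show "zariski_closure k X \<subseteq> curve k"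
  proof
    fix p assume p: "p \<in> zariski_closure k X"
    then obtain v where v: "v \<in> carrier_vec (k + 1)" "v \<noteq> 0\<^sub>v (k + 1)" "p = proj_pt v"
      by (auto simp: zariski_closure_def proj_space_def)
    have zero: "h v = 0" if h: "hom_poly (k + 1) d h" and g: "\<And>t. h (gamv k t) = 0" for d h
    proof -
      have "h w = 0" if q: "q \<in> curve k" "w \<in> q" for q w
      proof -
        obtain x where x: "q = gam k x" using q(1) by (auto simp: curve_def)
        show ?thesis
        proof (cases x)
          case None
          then obtain c where "w = c \<cdot>\<^sub>v unit_vec (k + 1) k" using x q(2) by (auto simp: proj_pt_def)
          then show ?thesis
            using hom_poly_smult[OF h] hom_poly_zero_on_curve(2)[OF h _ infinite_UNIV_char_0 g] k by simp
        next
          case (Some t)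
          then obtain c where "w = c \<cdot>\<^sub>v gamv k t"
            using x q(2) by (auto simp: gam_Some proj_pt_def simp del: gam.simps)
          then show ?thesis using hom_poly_smult[OF h gamv_carrier] g by simp
        qed
      qed
      then show ?thesis
        using p h X proj_pt_self[of v] unfolding zariski_closure_def v(3) by blast
    qed
    show "p \<in> curve k" unfolding v(3)
    proof (rule curve_equations[OF k v(1,2)])
      show "v $ 0 ^ (i - 1) * v $ i = v $ 1 ^ i" if i: "1 \<le> i" "i < k" for i
      proof -
        have "hom_poly (k + 1) (i - 1 + 1) (\<lambda>v. v $ 0 ^ (i - 1) * v $ i)"
          using i by (intro hom_poly.mult hom_poly_coord_power hom_poly.coord) auto
        moreover have "hom_poly (k + 1) i (\<lambda>v. v $ 1 ^ i)"
          using k by (intro hom_poly_coord_power) auto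
        ultimately have "hom_poly (k + 1) i (\<lambda>v. v $ 0 ^ (i - 1) * v $ i - v $ 1 ^ i)"
          using i by (intro hom_poly_diff) auto
        then have "v $ 0 ^ (i - 1) * v $ i - v $ 1 ^ i = 0"
          by (rule zero) (use i in \<open>simp add: gamv_index cusp_exp_def\<close>)
        then show ?thesis by simp
      qed
      have "hom_poly (k + 1) (k + 1) (\<lambda>v. v $ 0 ^ k * v $ k)"
        using k by (intro hom_poly.mult hom_poly_coord_power hom_poly.coord) auto
      moreover have "hom_poly (k + 1) (k + 1) (\<lambda>v. v $ 1 ^ (k + 1))"
        using k by (intro hom_poly_coord_power) auto
      ultimately have "hom_poly (k + 1) (k + 1) (\<lambda>v. v $ 0 ^ k * v $ k - v $ 1 ^ (k + 1))"
        by (rule hom_poly_diff)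
      then have "v $ 0 ^ k * v $ k - v $ 1 ^ (k + 1) = 0"
        by (rule zero) (use k in \<open>simp add: gamv_index cusp_exp_def\<close>)
      then show "v $ 0 ^ k * v $ k = v $ 1 ^ (k + 1)" by simp
      show "v $ i ^ (k + 1) = v $ 0 ^ (k + 1 - i) * v $ k ^ i" if i: "1 \<le> i" "i < k" for i
      proof -
        have "hom_poly (k + 1) (k + 1 - i + i) (\<lambda>v. v $ 0 ^ (k + 1 - i) * v $ k ^ i)"
          by (intro hom_poly.mult hom_poly_coord_power) auto
        then have "hom_poly (k + 1) (k + 1) (\<lambda>v. v $ 0 ^ (k + 1 - i) * v $ k ^ i)"
          using i by simp
        moreover have "hom_poly (k + 1) (k + 1) (\<lambda>v. v $ i ^ (k + 1))"
          using i by (intro hom_poly_coord_power) auto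
        ultimately have "hom_poly (k + 1) (k + 1)
            (\<lambda>v. v $ i ^ (k + 1) - v $ 0 ^ (k + 1 - i) * v $ k ^ i)"
          by (intro hom_poly_diff)
        then have "v $ i ^ (k + 1) - v $ 0 ^ (k + 1 - i) * v $ k ^ i = 0"
          by (rule zero)
            (use i in \<open>simp add: gamv_index cusp_exp_def power_mult[symmetric] mult.commute del: power_Suc\<close>)
        then show ?thesis by simp
      qed
    qed
  qed
next
  show "curve k \<subseteq> zariski_closure k X"
  proof
    fix p assume p: "p \<in> curve k"
    have "h w = 0" if h: "hom_poly (k + 1) d h" and van: "\<forall>q\<in>X. \<forall>v\<in>q. h v = 0" and w: "w \<in> p" for d h w
    proof -
      have "h (gamv k u) = 0" if "gam k (Some u) \<in> X" for u
        using van that proj_pt_self[of "gamv k u"] unfolding gam_Some by blast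
      note zero = hom_poly_zero_on_curve[OF h _ inf, simplified mem_Collect_eq, OF _ this]
      obtain x where x: "p = gam k x" using p by (auto simp: curve_def)
      show ?thesis
      proof (cases x)
        case None
        then obtain c where "w = c \<cdot>\<^sub>v unit_vec (k + 1) k" using x w by (auto simp: proj_pt_def)
        then show ?thesis using hom_poly_smult[OF h] zero(2) k by simp
      next
        case (Some t)
        then obtain c where "w = c \<cdot>\<^sub>v gamv k t"
          using x w by (auto simp: gam_Some proj_pt_def simp del: gam.simps)
        then show ?thesis using hom_poly_smult[OF h gamv_carrier] zero(1) k by simp
      qed
    qed
    then show "p \<in> zariski_closure k X"
      using p curve_in_proj_space[OF k] by (auto simp: zariski_closure_def)
  qed
qed

text \<open>Off the curve \<open>inv_into\<close> picks an unspecified parameter, so the value lies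
  on the curve for every argument.\<close>

definition cusp_aut :: "nat \<Rightarrow> complex \<Rightarrow> complex \<Rightarrow> complex vec set \<Rightarrow> complex vec set" where
  "cusp_aut k \<delta> \<tau> p = gam k (map_option (\<lambda>s. \<delta> * s + \<tau>) (inv_into UNIV (gam k) p))"

lemma cusp_aut_gam:
  "k \<ge> 2 \<Longrightarrow> cusp_aut k \<delta> \<tau> (gam k t) = gam k (map_option (\<lambda>s. \<delta> * s + \<tau>) t)"
  by (simp add: cusp_aut_def inv_f_f[OF inj_gam] del: gam.simps)

lemma proj_pt_smult_nonzero:
  assumes "u = c \<cdot>\<^sub>v w" "u \<noteq> 0\<^sub>v n" "w \<in> carrier_vec n"
  shows "proj_pt u = proj_pt w"
proof -
  have "c \<noteq> 0" using assms by auto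
  then show ?thesis by (simp add: assms(1) proj_pt_smult)
qed

text \<open>Near the cusp the automorphism is not given by substituting into the parametrization;
  the Cremona map itself, which is defined there, provides the required tuple.\<close>

lemma regular_cusp_aut:
  assumes k: "k \<ge> 2" and \<delta>: "\<delta> \<noteq> 0" and a: "inj_on a {0..k}" "asum k a \<noteq> 0"
  shows "regular_on k (curve k) (cusp_aut k \<delta> (tshift k \<delta> a))"
  unfolding regular_on_def
proof
  define \<tau> where "\<tau> = tshift k \<delta> a"
  fix p assume "p \<in> curve k"
  then obtain x where x: "p = gam k x" by (auto simp: curve_def)
  show "\<exists>d f. hom_poly_map k d f \<and> (\<forall>v\<in>p. f v \<noteq> 0\<^sub>v (k + 1)) \<and>
      (\<forall>q\<in>curve k. \<forall>v\<in>q. f v \<noteq> 0\<^sub>v (k + 1) \<longrightarrow> cusp_aut k \<delta> (tshift k \<delta> a) q = proj_pt (f v))"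
  proof (cases x)
    case None
    let ?f = "cremona k (Smat k \<delta> a) (Lag k a)" and ?e = "unit_vec (k + 1) k :: complex vec"
    have S: "Smat k \<delta> a \<in> carrier_mat (k + 1) (k + 1)"
      using inv_pair_Smat[OF \<delta> a] by (simp add: inv_pair_def)
    have hom: "hom_poly_map k k ?f" by (rule hom_poly_map_cremona[OF S Lag_carrier])
    define m where "m = - (\<delta> ^ (k + 1) * (\<Prod>j\<in>{0..k}. lag_coeff k a j))"
    have m: "m \<noteq> 0" using \<delta> lag_coeff_nonzero[OF a] by (simp add: m_def)
    have e: "?e \<in> carrier_vec (k + 1)" by simp
    have fe: "?f (c \<cdot>\<^sub>v ?e) = (c ^ k * m) \<cdot>\<^sub>v ?e" for c
      using hom_poly_map_smult[OF hom e] cremona_Smat_cusp[OF \<delta> a]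
      by (simp add: m_def smult_smult_assoc)
    show ?thesis
    proof (intro exI conjI ballI impI)
      show "hom_poly_map k k ?f" by (rule hom)
      show "?f v \<noteq> 0\<^sub>v (k + 1)" if v: "v \<in> p" for v
      proof -
        obtain c where c: "c \<noteq> 0" "v = c \<cdot>\<^sub>v ?e" using v unfolding x None by (auto simp: proj_pt_def)
        have "?f v $ k \<noteq> 0\<^sub>v (k + 1) $ k" using c m by (simp add: fe del: One_nat_def)
        then show ?thesis by fastforce
      qed
      show "cusp_aut k \<delta> (tshift k \<delta> a) q = proj_pt (?f v)"
        if q: "q \<in> curve k" "v \<in> q" "?f v \<noteq> 0\<^sub>v (k + 1)" for q v
      proof -
        obtain y where y: "q = gam k y" using q(1) by (auto simp: curve_def)
        show ?thesis
        proof (cases y)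
          case None
          then obtain c where c: "v = c \<cdot>\<^sub>v ?e" using q(2) y by (auto simp: proj_pt_def)
          have "proj_pt (?f v) = proj_pt ?e"
            by (rule proj_pt_smult_nonzero[OF _ q(3) e]) (simp add: c fe del: One_nat_def)
          then show ?thesis using None y cusp_aut_gam[OF k, of _ _ None] by simp
        next
          case (Some s)
          then obtain c where c: "v = c \<cdot>\<^sub>v gamv k s"
            using q(2) y by (auto simp: gam_Some proj_pt_def simp del: gam.simps)
          have "proj_pt (?f v) = proj_pt (gamv k (\<delta> * s + tshift k \<delta> a))"
            by (rule proj_pt_smult_nonzero[OF _ q(3) gamv_carrier])
              (use k in \<open>simp only: c hom_poly_map_smult[OF hom gamv_carrier]
                cremona_Smat_gamv[OF _ \<delta> a] smult_smult_assoc\<close>)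
          then show ?thesis using Some y cusp_aut_gam[OF k, of _ _ "Some s"] by (simp add: gam_Some del: gam.simps)
        qed
      qed
    qed
  next
    case (Some t)
    \<comment> \<open>The homogenization of g(\<delta> t + \<tau>) with t = x_1 / x_0. It vanishes
      at the cusp, where x_0 = x_1 = 0, so it makes no claim there.\<close>
    define f where "f v = vec (k + 1)
      (\<lambda>i. v $ 0 ^ (k + 1 - cusp_exp k i) * (\<delta> * v $ 1 + \<tau> * v $ 0) ^ cusp_exp k i)" for v
    have hom: "hom_poly_map k (k + 1) f"
      unfolding hom_poly_map_def
    proof (intro exI conjI allI impI ballI)
      fix i assume i: "i \<le> k"
      have "hom_poly (k + 1) 1 (\<lambda>v. \<delta> * v $ 1 + \<tau> * v $ 0)"
        using k by (intro hom_poly.add hom_poly_cmult hom_poly.coord) auto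
      from hom_poly_power[OF this, of "cusp_exp k i"]
      have "hom_poly (k + 1) (k + 1 - cusp_exp k i + cusp_exp k i)
          (\<lambda>v. v $ 0 ^ (k + 1 - cusp_exp k i) * (\<delta> * v $ 1 + \<tau> * v $ 0) ^ cusp_exp k i)"
        by (intro hom_poly.mult hom_poly_coord_power) auto
      then show "hom_poly (k + 1) (k + 1)
          (\<lambda>v. v $ 0 ^ (k + 1 - cusp_exp k i) * (\<delta> * v $ 1 + \<tau> * v $ 0) ^ cusp_exp k i)"
        by (simp add: cusp_exp_def split: if_splits)
    qed (simp add: f_def)
    have fg: "f (gamv k s) = gamv k (\<delta> * s + \<tau>)" for s
      using k by (intro eq_vecI) (auto simp: f_def gamv_def cusp_exp_def)
    show ?thesis
    proof (intro exI conjI ballI impI)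
      show "hom_poly_map k (k + 1) f" by (rule hom)
      show "f v \<noteq> 0\<^sub>v (k + 1)" if v: "v \<in> p" for v
      proof -
        obtain c where c: "c \<noteq> 0" "v = c \<cdot>\<^sub>v gamv k t"
          using v x Some by (auto simp: gam_Some proj_pt_def simp del: gam.simps)
        have "f v $ 0 \<noteq> 0\<^sub>v (k + 1) $ 0"
          unfolding c(2) hom_poly_map_smult[OF hom gamv_carrier] fg using c(1) k
          by (simp add: gamv_0 del: power_Suc)
        then show ?thesis by fastforce
      qed
      show "cusp_aut k \<delta> (tshift k \<delta> a) q = proj_pt (f v)"
        if q: "q \<in> curve k" "v \<in> q" "f v \<noteq> 0\<^sub>v (k + 1)" for q v
      proof -
        obtain y where y: "q = gam k y" using q(1) by (auto simp: curve_def)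
        show ?thesis
        proof (cases y)
          case None
          then obtain c where c: "v = c \<cdot>\<^sub>v unit_vec (k + 1) k" using q(2) y by (auto simp: proj_pt_def)
          have "f v = 0\<^sub>v (k + 1)"
            unfolding c f_def using k by (intro eq_vecI) (auto simp: cusp_exp_def)
          then show ?thesis using q(3) by simp
        next
          case (Some s)
          then obtain c where c: "v = c \<cdot>\<^sub>v gamv k s"
            using q(2) y by (auto simp: gam_Some proj_pt_def simp del: gam.simps)
          have "proj_pt (f v) = proj_pt (gamv k (\<delta> * s + \<tau>))"
            by (rule proj_pt_smult_nonzero[OF _ q(3) gamv_carrier])
              (simp only: c hom_poly_map_smult[OF hom gamv_carrier] fg)
          then show ?thesis using Some y cusp_aut_gam[OF k, of _ _ "Some s"]
            by (simp add: gam_Some \<tau>_def del: gam.simps)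
        qed
      qed
    qed
  qed
qed

text \<open>Regularity at the cusp is available only for translations of the form
  \<open>tshift\<close>. The inverse parameter change has this form for 1/\<delta> and the nodes
  \<open>tpts k \<delta> a\<close>, since their sum is -\<delta> times the old one.\<close>

lemma variety_aut_cusp_aut:
  assumes k: "k \<ge> 2" and \<delta>: "\<delta> \<noteq> 0" and a: "inj_on a {0..k}" "asum k a \<noteq> 0"
  shows "variety_aut k (curve k) (cusp_aut k \<delta> (tshift k \<delta> a))"
proof -
  define \<tau> where "\<tau> = tshift k \<delta> a"
  define \<tau>' where "\<tau>' = tshift k (1 / \<delta>) (tpts k \<delta> a)"
  let ?f = "cusp_aut k \<delta> \<tau>" and ?g = "cusp_aut k (1 / \<delta>) \<tau>'"
  have \<tau>': "\<tau>' = - \<tau> / \<delta>" using \<delta> by (simp add: \<tau>'_def \<tau>_def tshift_def asum_tpts)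
  have gf: "?g (?f p) = p" and fg: "?f (?g p) = p" if "p \<in> curve k" for p
    using that \<delta> by (auto simp: curve_def cusp_aut_gam[OF k] option.map_comp comp_def \<tau>'
        field_simps option.map_ident simp del: gam.simps)
  have map: "?f p \<in> curve k" "?g p \<in> curve k" for p
    by (simp_all add: cusp_aut_def curve_def)
  have bij: "bij_betw ?f (curve k) (curve k)"
    by (rule bij_betw_byWitness[of _ ?g]) (use gf fg map in auto)
  have inv: "inv_into (curve k) ?f q = ?g q" if "q \<in> curve k" for q
    using inv_into_f_f[OF bij_betw_imp_inj_on[OF bij] map(2)[of q]] fg[OF that] by simp
  have "regular_on k (curve k) ?g"
    unfolding \<tau>'_def using a \<delta> by (intro regular_cusp_aut[OF k] inj_on_tpts) (auto simp: asum_tpts)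
  then have "regular_on k (curve k) (inv_into (curve k) ?f)"
    unfolding regular_on_def using inv by (simp cong: ball_cong)
  then show ?thesis
    using bij regular_cusp_aut[OF assms] unfolding variety_aut_def \<tau>_def by blast
qed

subsection \<open>Existence and uniqueness\<close>

lemma apply_aut_proj_pt:
  assumes "A \<in> carrier_mat (k + 1) (k + 1)" "v \<in> carrier_vec (k + 1)"
  shows "apply_aut A (proj_pt v) = proj_pt (A *\<^sub>v v)"
  unfolding apply_aut_def proj_pt_def using mult_mat_vec[OF assms] by (auto intro!: image_eqI)

lemma apply_aut_coord_pt:
  assumes A: "A \<in> carrier_mat (k + 1) (k + 1)" and j: "j \<le> k"
  shows "apply_aut A (coord_pt k j) = proj_pt (col A j)"
proof -
  have "A *\<^sub>v unit_vec (k + 1) j = col A j"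
    using assms by (intro eq_vecI) auto
  then show ?thesis
    unfolding coord_pt_def using apply_aut_proj_pt[OF A, of "unit_vec (k + 1) j"] by simp
qed

lemma apply_aut_Gam: "j \<le> k \<Longrightarrow> apply_aut (Gam k a) (coord_pt k j) = gam k (Some (a j))"
  by (simp only: apply_aut_coord_pt[OF Gam_carrier] col_Gam gam_Some)

lemma col_mult_diag:
  fixes A :: "complex mat"
  assumes "A \<in> carrier_mat n n" "j < n"
  shows "col (A * mat_diag n f) j = f j \<cdot>\<^sub>v col A j"
  unfolding mat_diag_mult_right[OF assms(1)] using assms by (intro eq_vecI) (auto simp: mult.commute)

lemma smult_one_mult_vec:
  "w \<in> carrier_vec n \<Longrightarrow> (c \<cdot>\<^sub>m 1\<^sub>m n) *\<^sub>v w = c \<cdot>\<^sub>v (w :: 'a :: comm_ring_1 vec)"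
  by (intro eq_vecI) auto

lemma mult_mat_diag_vec:
  assumes A: "A \<in> carrier_mat (k + 1) (k + 1)" and w: "w \<in> carrier_vec (k + 1)"
  shows "(A * mat_diag (k + 1) f) *\<^sub>v w = A *\<^sub>v vec (k + 1) (\<lambda>i. f i * w $ i)"
  using assoc_mult_mat_vec[OF A mat_diag_dim w] unfolding mat_diag_mult_vec[OF w] .

lemma Lag_gamv_nonzero:
  assumes "inj_on a {0..k}" "asum k a \<noteq> 0" "i \<le> k"
    and "t \<notin> a ` {0..k}" "t \<notin> (\<lambda>j. a j - asum k a) ` {0..k}"
  shows "(Lag k a *\<^sub>v gamv k t) $ i \<noteq> 0"
proof -
  have "t - a i + asum k a \<noteq> 0" using assms(3,5) by (auto simp: algebra_simps)
  moreover have "(\<Prod>j\<in>{0..k} - {i}. t - a j) \<noteq> 0" using assms(4) by auto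
  ultimately show ?thesis
    using lag_coeff_nonzero[OF assms(1-3)] assms(3) by (simp add: Lag_gamv poly_lag_poly)
qed

lemma not_indet:
  assumes "rat_rep k f" "v \<in> carrier_vec (k + 1)" "f v \<noteq> 0\<^sub>v (k + 1)"
  shows "proj_pt v \<notin> indet k (rat_class k f)"
  using assms rat_class_self proj_pt_self unfolding indet_def by blast

text \<open>The minors are polynomials in t, so those vanishing on U are zero. This reaches the
  parameters where the explicit tuple vanishes but another representative may not.\<close>

lemma par_on_curve_extend:
  assumes g: "rat_rep k g" and U: "infinite U"
    and par: "\<And>t. t \<in> U \<Longrightarrow> par k (g (gamv k t)) (gamv k (\<delta> * t + \<tau>))"
  shows "par k (g (gamv k t)) (gamv k (\<delta> * t + \<tau>))"
proof -
  obtain d p where p: "\<And>i. i \<le> k \<Longrightarrow> hom_poly (k + 1) d (p i)"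
    "\<And>v. v \<in> carrier_vec (k + 1) \<Longrightarrow> g v = vec (k + 1) (\<lambda>i. p i v)"
    using g unfolding rat_rep_def hom_poly_map_def by auto
  define Q where "Q i = [:\<tau>, \<delta>:] ^ cusp_exp k i" for i
  have Q: "gamv k (\<delta> * t + \<tau>) $ i = poly (Q i) t" if "i \<le> k" for i t
    using that by (simp add: gamv_index Q_def algebra_simps)
  have "\<exists>R. \<forall>t. g (gamv k t) $ i = poly R t" if i: "i \<le> k" for i
  proof -
    obtain R where "\<forall>t. p i (vec (k + 1) (\<lambda>i. poly (monom 1 (cusp_exp k i)) t)) = poly R t"
      using hom_poly_along_poly_curve[OF p(1)[OF i], of "\<lambda>i. monom 1 (cusp_exp k i)"] by blast
    then have "p i (gamv k t) = poly R t" for t by (simp add: gamv_def poly_monom)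
    then have "g (gamv k t) $ i = poly R t" for t unfolding p(2)[OF gamv_carrier] using i by simp
    then show ?thesis by blast
  qed
  then obtain R where R: "\<And>i t. i \<le> k \<Longrightarrow> g (gamv k t) $ i = poly (R i) t" by metis
  have "R i * Q j = R j * Q i" if "i \<le> k" "j \<le> k" for i j
    by (rule poly_eq_if_infinite[OF U])
      (use par that in \<open>simp add: par_def R Q\<close>)
  then show ?thesis by (simp add: par_def R Q flip: poly_mult)
qed

definition sol :: "nat \<Rightarrow> complex \<Rightarrow> (nat \<Rightarrow> complex) \<Rightarrow> rat_map" where
  "sol k \<delta> a = rat_class k (cremona k (Smat k \<delta> a) (Lag k a))"

section \<open>The explicit solution and its uniqueness for fixed data\<close>

context
  fixes k :: nat and \<delta> :: complex and a :: "nat \<Rightarrow> complex"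
  assumes k: "k \<ge> 2" and \<delta>: "\<delta> \<noteq> 0" and inj: "inj_on a {0..k}" and sum: "asum k a \<noteq> 0"
begin

lemma k1: "k \<ge> 1"
  using k by simp

lemma Lag_Gam: "inv_pair k (Lag k a) (Gam k a)"
  by (rule inv_pair_sym[OF inv_pair_Gam_Lag[OF inj sum]])

lemma sol_rep: "rat_rep k (cremona k (Smat k \<delta> a) (Lag k a))"
  by (rule rat_rep_cremona[OF inv_pair_Smat[OF \<delta> inj sum] Lag_Gam])

lemma basic_cremona_sol: "basic_cremona k (Smat k \<delta> a) (Gam k a) (sol k \<delta> a)"
  unfolding sol_def
  by (rule basic_cremona_class[OF k1 inv_pair_Smat[OF \<delta> inj sum] inv_pair_sym[OF Lag_Gam]])

lemma sol_gamv:
  assumes "t \<notin> a ` {0..k}"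
  obtains l where "l \<noteq> 0"
    "cremona k (Smat k \<delta> a) (Lag k a) (gamv k t) = l \<cdot>\<^sub>v gamv k (\<delta> * t + tshift k \<delta> a)"
proof
  show "- ((\<Prod>j\<in>{0..k}. t - a j) ^ (k - 1) * (\<Prod>j\<in>{0..k}. lag_coeff k a j)) \<noteq> 0"
    using assms lag_coeff_nonzero[OF inj sum] by auto
qed (rule cremona_Smat_gamv[OF k1 \<delta> inj sum])

lemma smult_gamv_nonzero: "l \<noteq> 0 \<Longrightarrow> l \<cdot>\<^sub>v gamv k t \<noteq> 0\<^sub>v (k + 1)"
proof
  assume "l \<noteq> 0" "l \<cdot>\<^sub>v gamv k t = 0\<^sub>v (k + 1)"
  then have "(l \<cdot>\<^sub>v gamv k t) $ 0 = 0" by simp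
  then show False using \<open>l \<noteq> 0\<close> gamv_0[OF k1, of t] by simp
qed

lemma infinite_compl: "finite A \<Longrightarrow> infinite (UNIV - A :: complex set)"
  by (simp add: infinite_UNIV_char_0)

text \<open>At a finite parameter the nonvanishing representative g may differ from the explicit
  tuple. It is parallel to it off the nodes, and \<open>par_on_curve_extend\<close> carries this
  over to t; whether the nodes belong to the indeterminacy locus need not be decided.\<close>

lemma sol_eval:
  assumes p: "p \<in> curve k" "p \<notin> indet k (sol k \<delta> a)"
  shows "rat_eval k (sol k \<delta> a) p = cusp_aut k \<delta> (tshift k \<delta> a) p"
proof -
  obtain x where x: "p = gam k x" using p(1) by (auto simp: curve_def)
  show ?thesis
  proof (cases x)
    case None
    let ?e = "unit_vec (k + 1) k :: complex vec" and ?f = "cremona k (Smat k \<delta> a) (Lag k a)"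
    have e: "?e \<in> carrier_vec (k + 1)" by simp
    have "?f ?e $ k \<noteq> 0\<^sub>v (k + 1) $ k"
      using \<delta> lag_coeff_nonzero[OF inj sum] by (simp add: cremona_Smat_cusp[OF \<delta> inj sum] del: One_nat_def)
    then have ne: "?f ?e \<noteq> 0\<^sub>v (k + 1)" by fastforce
    have "rat_eval k (sol k \<delta> a) p = proj_pt (?f ?e)"
      unfolding x None gam.simps sol_def by (rule rat_eval_class[OF sol_rep e ne])
    also have "\<dots> = proj_pt ?e"
      by (rule proj_pt_smult_nonzero[OF cremona_Smat_cusp[OF \<delta> inj sum] ne e])
    finally show ?thesis using cusp_aut_gam[OF k, of _ _ None] x None by simp
  next
    case (Some t)
    have "p \<in> proj_space k" using p(1) curve_in_proj_space[OF k] by blast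
    then obtain g v where g: "g \<in> sol k \<delta> a" and v: "v \<in> p" "g v \<noteq> 0\<^sub>v (k + 1)"
      using p(2) by (auto simp: indet_def)
    have fg: "rat_equiv k (cremona k (Smat k \<delta> a) (Lag k a)) g"
      using g by (simp add: sol_def rat_class_def)
    then have rep: "rat_rep k g" by (simp add: rat_equiv_def)
    obtain d where d: "hom_poly_map k d g" using rep by (rule rat_repE)
    obtain c where c: "c \<noteq> 0" "v = c \<cdot>\<^sub>v gamv k t"
      using v(1) x Some by (auto simp: gam_Some proj_pt_def simp del: gam.simps)
    have vc: "v \<in> carrier_vec (k + 1)" unfolding c smult_carrier_vec by (rule gamv_carrier)
    have "par k (g (gamv k t)) (gamv k (\<delta> * t + tshift k \<delta> a))"
    proof (rule par_on_curve_extend[OF rep infinite_compl[of "a ` {0..k}"]])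
      fix s assume "s \<in> UNIV - a ` {0..k}"
      then obtain l where l: "l \<noteq> 0"
        "cremona k (Smat k \<delta> a) (Lag k a) (gamv k s) = l \<cdot>\<^sub>v gamv k (\<delta> * s + tshift k \<delta> a)"
        using sol_gamv[of s] by auto
      have "par k (l \<cdot>\<^sub>v gamv k (\<delta> * s + tshift k \<delta> a)) (g (gamv k s))"
        using fg gamv_carrier[of k s] unfolding rat_equiv_par l(2)[symmetric] by blast
      from par_sym[OF par_smult_left[OF _ this, of "inverse l"]]
      show "par k (g (gamv k s)) (gamv k (\<delta> * s + tshift k \<delta> a))"
        using l(1) gamv_carrier[of k "\<delta> * s + tshift k \<delta> a"] by (simp add: smult_smult_assoc)
    qed simp
    then have par: "par k (g v) (gamv k (\<delta> * t + tshift k \<delta> a))"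
      unfolding c(2) hom_poly_map_smult[OF d gamv_carrier]
      by (rule par_smult_left[OF rat_rep_carrier[OF rep gamv_carrier]])
    have "sol k \<delta> a = rat_class k g" unfolding sol_def by (rule rat_class_eq[OF fg])
    moreover have "p = proj_pt v" unfolding x Some gam_Some c(2) by (rule proj_pt_smult[OF c(1), symmetric])
    ultimately have "rat_eval k (sol k \<delta> a) p = proj_pt (g v)"
      using rat_eval_class[OF rep vc v(2)] by simp
    also have "\<dots> = proj_pt (gamv k (\<delta> * t + tshift k \<delta> a))"
      by (rule proj_pt_par[OF rat_rep_carrier[OF rep vc] gamv_carrier par v(2) gamv_nonzero[OF k1]])
    finally show ?thesis
      using cusp_aut_gam[OF k, of _ _ "Some t"] x Some by (simp add: gam_Some del: gam.simps)
  qed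
qed

lemma properly_fixes_by_sol: "properly_fixes_by k (sol k \<delta> a) \<delta> (tshift k \<delta> a)"
  unfolding properly_fixes_by_def properly_fixes_curve_def
proof (intro conjI exI allI)
  show "centered_on_curve k (sol k \<delta> a)"
    unfolding centered_on_curve_def using basic_cremona_sol
    by (intro exI conjI allI impI) (auto simp: apply_aut_Gam C_reg_def simp del: gam.simps)
  let ?X = "rat_eval k (sol k \<delta> a) ` (curve k - indet k (sol k \<delta> a))"
  show "proper_transform k (sol k \<delta> a) (curve k) = curve k"
    unfolding proper_transform_def
  proof (rule zariski_closure_in_curve[OF k])
    show "?X \<subseteq> curve k" using sol_eval by (auto simp: cusp_aut_def curve_def)
    have "gam k (Some (\<delta> * t + tshift k \<delta> a)) \<in> ?X" if t: "t \<notin> a ` {0..k}" for t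
    proof -
      have "cremona k (Smat k \<delta> a) (Lag k a) (gamv k t) \<noteq> 0\<^sub>v (k + 1)"
        using sol_gamv[OF t] smult_gamv_nonzero by metis
      then have "gam k (Some t) \<notin> indet k (sol k \<delta> a)"
        unfolding gam_Some sol_def by (rule not_indet[OF sol_rep gamv_carrier])
      moreover have "gam k (Some t) \<in> curve k" unfolding curve_def by blast
      ultimately show ?thesis
        using sol_eval[of "gam k (Some t)"] cusp_aut_gam[OF k, of \<delta> "tshift k \<delta> a" "Some t"]
        by (intro image_eqI[of _ _ "gam k (Some t)"]) (auto simp del: gam.simps)
    qed
    then have "(\<lambda>t. \<delta> * t + tshift k \<delta> a) ` (UNIV - a ` {0..k}) \<subseteq> {u. gam k (Some u) \<in> ?X}"
      by blast
    moreover have "infinite ((\<lambda>t. \<delta> * t + tshift k \<delta> a) ` (UNIV - a ` {0..k}))"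
      using infinite_compl[of "a ` {0..k}"] \<delta> by (subst finite_image_iff) (auto simp: inj_on_def)
    ultimately show "infinite {u. gam k (Some u) \<in> ?X}" using finite_subset by blast
  qed
  show "induced_aut k (sol k \<delta> a) (cusp_aut k \<delta> (tshift k \<delta> a))"
    unfolding induced_aut_def using variety_aut_cusp_aut[OF k \<delta> inj sum] sol_eval by auto
  show "cusp_aut k \<delta> (tshift k \<delta> a) (gam k t) = gam k (map_option (\<lambda>s. \<delta> * s + tshift k \<delta> a) t)" for t
    by (rule cusp_aut_gam[OF k])
qed

text \<open>Rescaling the columns of $T$ can be compensated in $S$.\<close>

lemma basic_cremona_normalized:
  assumes F: "basic_cremona k S T F"
    and T: "\<And>j. j \<le> k \<Longrightarrow> apply_aut T (coord_pt k j) = gam k (Some (a j))"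
  obtains m S1i where "\<forall>j\<le>k. m j \<noteq> 0" "S \<in> carrier_mat (k + 1) (k + 1)"
    "inv_pair k (S * mat_diag (k + 1) m) S1i"
    "F = rat_class k (cremona k (S * mat_diag (k + 1) m) (Lag k a))"
proof -
  obtain Si Ti where S: "inv_pair k S Si" and TT: "inv_pair k T Ti"
    and FS: "F = rat_class k (cremona k S Ti)" using F by (rule basic_cremonaE)
  have cS: "S \<in> carrier_mat (k + 1) (k + 1)" and cT: "T \<in> carrier_mat (k + 1) (k + 1)"
    using S TT by (auto simp: inv_pair_def)
  \<comment> \<open>Equality of points fixes each column of T only up to a nonzero factor, which
    becomes \<open>m j\<close>.\<close>
  have "\<exists>c. c \<noteq> 0 \<and> col T j = c \<cdot>\<^sub>v gamv k (a j)" if j: "j \<le> k" for j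
    using T[OF j] unfolding apply_aut_coord_pt[OF cT j] gam_Some by (rule proj_pt_eqD)
  then obtain m where m: "\<And>j. j \<le> k \<Longrightarrow> m j \<noteq> 0" "\<And>j. j \<le> k \<Longrightarrow> col T j = m j \<cdot>\<^sub>v gamv k (a j)"
    by metis
  let ?D = "mat_diag (k + 1) m" and ?Di = "mat_diag (k + 1) (\<lambda>i. inverse (m i))"
  have D: "inv_pair k ?D ?Di" using m(1) by (rule inv_pair_diag)
  have T_eq: "T = Gam k a * ?D"
  proof (rule mat_col_eqI)
    fix j assume "j < dim_col (Gam k a * ?D)"
    then have j: "j \<le> k" by (simp add: mat_diag_def)
    then show "col T j = col (Gam k a * ?D) j"
      using col_mult_diag[OF Gam_carrier, of j k a m] by (simp add: m(2)[OF j] col_Gam[OF j])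
  qed (use cT Gam_carrier[of k a] in \<open>auto simp: mat_diag_def\<close>)
  have Ti: "Ti = ?Di * Lag k a"
    using inv_pair_unique[OF TT, unfolded T_eq, OF inv_pair_mult[OF inv_pair_sym[OF Lag_Gam] D]] .
  have eq: "cremona k S Ti v = inverse (\<Prod>j\<in>{0..k}. m j) \<cdot>\<^sub>v cremona k (S * ?D) (Lag k a) v"
    if v: "v \<in> carrier_vec (k + 1)" for v
  proof -
    define w where "w = Lag k a *\<^sub>v v"
    have w: "w \<in> carrier_vec (k + 1)" unfolding w_def by (rule mult_mat_vec_carrier[OF Lag_carrier v])
    have "Ti *\<^sub>v v = vec (k + 1) (\<lambda>i. inverse (m i) * w $ i)"
      unfolding Ti using assoc_mult_mat_vec[OF mat_diag_dim Lag_carrier v, of "\<lambda>i. inverse (m i)" a]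
      by (simp only: w_def[symmetric] mat_diag_mult_vec[OF w])
    \<comment> \<open>J inverts a diagonal scaling up to a common factor, so the inverse factors
      coming from \<open>Ti\<close> reappear as \<open>m\<close>, to be absorbed into S.\<close>
    moreover have "Jv k (vec (k + 1) (\<lambda>i. inverse (m i) * w $ i)) =
        inverse (\<Prod>j\<in>{0..k}. m j) \<cdot>\<^sub>v vec (k + 1) (\<lambda>i. m i * Jv k w $ i)"
    proof (rule eq_vecI)
      fix i assume "i < dim_vec (inverse (\<Prod>j\<in>{0..k}. m j) \<cdot>\<^sub>v vec (k + 1) (\<lambda>i. m i * Jv k w $ i))"
      then have i: "i \<le> k" by simp
      have "Jv k (vec (k + 1) (\<lambda>i. inverse (m i) * w $ i)) $ i =
          (\<Prod>j\<in>{0..k} - {i}. inverse (m j) * w $ j)"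
        using i by (auto simp: Jv_def intro!: prod.cong)
      also have "\<dots> = inverse (\<Prod>j\<in>{0..k} - {i}. m j) * (\<Prod>j\<in>{0..k} - {i}. w $ j)"
        by (simp add: prod.distrib prod_inversef[symmetric] comp_def)
      also have "inverse (\<Prod>j\<in>{0..k} - {i}. m j) = inverse (\<Prod>j\<in>{0..k}. m j) * m i"
        using i m(1)[OF i] by (simp add: prod.remove[of "{0..k}" i])
      finally show "Jv k (vec (k + 1) (\<lambda>i. inverse (m i) * w $ i)) $ i =
          (inverse (\<Prod>j\<in>{0..k}. m j) \<cdot>\<^sub>v vec (k + 1) (\<lambda>i. m i * Jv k w $ i)) $ i"
        using i by (simp add: Jv_def)
    qed (simp add: Jv_def)
    ultimately show ?thesis
      unfolding cremona_def w_def[symmetric] mult_mat_diag_vec[OF cS Jv_carrier]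
      using mult_mat_vec[OF cS, of "vec (k + 1) (\<lambda>i. m i * Jv k w $ i)"] by simp
  qed
  have S1: "inv_pair k (S * ?D) (?Di * Si)" by (rule inv_pair_mult[OF S D])
  have cS1: "S * ?D \<in> carrier_mat (k + 1) (k + 1)" using S1 by (simp add: inv_pair_def)
  have "rat_equiv k (cremona k S Ti) (cremona k (S * ?D) (Lag k a))"
    unfolding rat_equiv_par
    using rat_rep_cremona[OF S inv_pair_sym[OF TT]] rat_rep_cremona[OF S1 Lag_Gam] eq
      par_smult_self[OF cremona_carrier[OF cS1]] by auto
  from rat_class_eq[OF this] that[OF _ cS S1] m(1) show ?thesis using FS by simp
qed

lemma basic_cremona_unique:
  assumes F: "basic_cremona k S T F" and pf: "properly_fixes_by k F \<delta> \<tau>"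
    and T: "\<And>j. j \<le> k \<Longrightarrow> apply_aut T (coord_pt k j) = gam k (Some (a j))"
  shows "\<tau> = tshift k \<delta> a" "F = sol k \<delta> a"
    "j \<le> k \<Longrightarrow> apply_aut S (coord_pt k j) = gam k (Some (tpts k \<delta> a j))"
proof -
  obtain m S1i where m: "\<forall>j\<le>k. m j \<noteq> 0" and cS: "S \<in> carrier_mat (k + 1) (k + 1)"
    and S1: "inv_pair k (S * mat_diag (k + 1) m) S1i"
    and FS: "F = rat_class k (cremona k (S * mat_diag (k + 1) m) (Lag k a))"
    using F T by (rule basic_cremona_normalized)
  define S' where "S' = S * mat_diag (k + 1) m"
  define f where "f = cremona k S' (Lag k a)"
  note S1 = S1[folded S'_def] and FS = FS[folded S'_def f_def]
  have rep: "rat_rep k f" unfolding f_def by (rule rat_rep_cremona[OF S1 Lag_Gam])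
  obtain \<phi> where \<phi>: "induced_aut k F \<phi>" "\<And>t. \<phi> (gam k t) = gam k (map_option (\<lambda>s. \<delta> * s + \<tau>) t)"
    using pf unfolding properly_fixes_by_def by blast
  obtain M where M: "inv_pair k (Smat k \<delta> a) M" using inv_pair_Smat[OF \<delta> inj sum] by blast
  have c: "S' \<in> carrier_mat (k + 1) (k + 1)" "M \<in> carrier_mat (k + 1) (k + 1)"
    "Smat k \<delta> a \<in> carrier_mat (k + 1) (k + 1)"
    using S1 M by (auto simp: inv_pair_def)
  \<comment> \<open>Both Cremona tuples start with the same \<open>Lag k a\<close> and J, so they
    differ by a linear map B after the explicit solution.\<close>
  define B where "B = S' * M"
  have B: "inv_pair k B (Smat k \<delta> a * S1i)"
    unfolding B_def by (rule inv_pair_mult[OF S1 inv_pair_sym[OF M]])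
  have f_eq: "f v = B *\<^sub>v cremona k (Smat k \<delta> a) (Lag k a) v" for v
    unfolding f_def B_def cremona_def
    using assoc_mult_mat_vec[OF c(1,2) mult_mat_vec_carrier[OF c(3) Jv_carrier]]
      inv_pair_cancel[OF inv_pair_sym[OF M] Jv_carrier] by simp
  \<comment> \<open>The zeros of all coordinates of \<open>Lag k a\<close> applied to g(t): the
    nodes and the additional roots. Off E neither tuple vanishes at g(t).\<close>
  define E where "E = a ` {0..k} \<union> (\<lambda>j. a j - asum k a) ` {0..k}"
  have main: "\<exists>l. B *\<^sub>v gamv k (\<delta> * t + tshift k \<delta> a) = l \<cdot>\<^sub>v gamv k (\<delta> * t + \<tau>)" if t: "t \<notin> E" for t
  proof -
    have ne: "f (gamv k t) \<noteq> 0\<^sub>v (k + 1)"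
      unfolding f_def
      by (rule cremona_nonzero[OF S1 Lag_carrier gamv_carrier])
        (rule Lag_gamv_nonzero[OF inj sum], use t in \<open>auto simp: E_def\<close>)
    have "gam k (Some t) \<in> curve k - indet k F"
      using not_indet[OF rep gamv_carrier ne] unfolding FS gam_Some curve_def
      by (auto simp: gam_Some[symmetric] simp del: gam.simps)
    then have "\<phi> (gam k (Some t)) = rat_eval k F (gam k (Some t))"
      using \<phi>(1) unfolding induced_aut_def by blast
    also have "\<dots> = proj_pt (f (gamv k t))"
      unfolding FS gam_Some by (rule rat_eval_class[OF rep gamv_carrier ne])
    finally have "proj_pt (f (gamv k t)) = proj_pt (gamv k (\<delta> * t + \<tau>))"
      using \<phi>(2)[of "Some t"] by (simp add: gam_Some del: gam.simps)
    then obtain c1 where c1: "f (gamv k t) = c1 \<cdot>\<^sub>v gamv k (\<delta> * t + \<tau>)" using proj_pt_eqD by blast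
    obtain l where l: "l \<noteq> 0"
      "cremona k (Smat k \<delta> a) (Lag k a) (gamv k t) = l \<cdot>\<^sub>v gamv k (\<delta> * t + tshift k \<delta> a)"
      using sol_gamv[of t] t by (auto simp: E_def)
    have cB: "B \<in> carrier_mat (k + 1) (k + 1)" using B by (simp add: inv_pair_def)
    have "l \<cdot>\<^sub>v (B *\<^sub>v gamv k (\<delta> * t + tshift k \<delta> a)) = c1 \<cdot>\<^sub>v gamv k (\<delta> * t + \<tau>)"
      using c1 unfolding f_eq l(2) mult_mat_vec[OF cB gamv_carrier] .
    then have "inverse l \<cdot>\<^sub>v (l \<cdot>\<^sub>v (B *\<^sub>v gamv k (\<delta> * t + tshift k \<delta> a))) =
        inverse l \<cdot>\<^sub>v (c1 \<cdot>\<^sub>v gamv k (\<delta> * t + \<tau>))" by simp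
    then have "B *\<^sub>v gamv k (\<delta> * t + tshift k \<delta> a) = (inverse l * c1) \<cdot>\<^sub>v gamv k (\<delta> * t + \<tau>)"
      using l(1) by (simp add: smult_smult_assoc)
    then show ?thesis by blast
  qed
  have inf: "infinite ((\<lambda>t. \<delta> * t + tshift k \<delta> a) ` (UNIV - E))"
    using infinite_compl[of E] \<delta> by (subst finite_image_iff) (auto simp: inj_on_def E_def)
  \<comment> \<open>In the parameter u = \<delta> t + \<open>tshift k \<delta> a\<close>, the
    discrepancy between \<tau> and the expected translation plays the role of \<epsilon>.\<close>
  have "\<tau> - tshift k \<delta> a = 0 \<and> (\<exists>c. c \<noteq> 0 \<and> B = c \<cdot>\<^sub>m 1\<^sub>m (k + 1))"
  proof (rule curve_translation_rigid[OF k1 B inf])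
    fix u assume "u \<in> (\<lambda>t. \<delta> * t + tshift k \<delta> a) ` (UNIV - E)"
    then obtain t where t: "t \<notin> E" "u = \<delta> * t + tshift k \<delta> a" by blast
    show "\<exists>l. B *\<^sub>v gamv k u = l \<cdot>\<^sub>v gamv k (u + (\<tau> - tshift k \<delta> a))"
      using main[OF t(1)] by (simp add: t(2) algebra_simps)
  qed
  then obtain b where \<tau>: "\<tau> = tshift k \<delta> a" and b: "b \<noteq> 0" "B = b \<cdot>\<^sub>m 1\<^sub>m (k + 1)" by auto
  show "\<tau> = tshift k \<delta> a" by (rule \<tau>)
  have f_b: "f v = b \<cdot>\<^sub>v cremona k (Smat k \<delta> a) (Lag k a) v" for v
    unfolding f_eq b(2)
    by (rule smult_one_mult_vec[OF cremona_carrier[OF c(3)]])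
  have "rat_equiv k f (cremona k (Smat k \<delta> a) (Lag k a))"
    unfolding rat_equiv_par f_b using rep sol_rep par_smult_self[OF cremona_carrier[OF c(3)]]
    by (auto simp: f_b[abs_def])
  then show "F = sol k \<delta> a" unfolding FS sol_def by (rule rat_class_eq)
  assume j: "j \<le> k"
  \<comment> \<open>Since B is scalar, S' is proportional to \<open>Smat\<close>; hence the columns
    of S span the same lines as those of \<open>Gam k (tpts k \<delta> a)\<close>.\<close>
  have "S' = B * Smat k \<delta> a"
  proof -
    have "B * Smat k \<delta> a = S' * (M * Smat k \<delta> a)" unfolding B_def by (rule assoc_mult_mat[OF c])
    then show ?thesis using M c(1) by (simp add: inv_pair_def)
  qed
  then have S': "S' = b \<cdot>\<^sub>m Smat k \<delta> a"
    using mult_smult_assoc_mat[OF one_carrier_mat c(3), of b] left_mult_one_mat[OF c(3)]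
    by (simp only: b(2))
  have "m j \<cdot>\<^sub>v col S j = col S' j" unfolding S'_def using col_mult_diag[OF cS, of j m] j by simp
  also have "\<dots> = b \<cdot>\<^sub>v col (Smat k \<delta> a) j" unfolding S' using c(3) j by (intro eq_vecI) auto
  also have "col (Smat k \<delta> a) j = lag_coeff k a j ^ 2 \<cdot>\<^sub>v gamv k (tpts k \<delta> a j)"
    unfolding Smat_def using col_mult_diag[OF Gam_carrier, of j] j by (simp add: col_Gam)
  finally have "m j \<cdot>\<^sub>v col S j = (b * lag_coeff k a j ^ 2) \<cdot>\<^sub>v gamv k (tpts k \<delta> a j)"
    by (simp add: smult_smult_assoc)
  then have "proj_pt (m j \<cdot>\<^sub>v col S j) = proj_pt ((b * lag_coeff k a j ^ 2) \<cdot>\<^sub>v gamv k (tpts k \<delta> a j))"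
    by simp
  then show "apply_aut S (coord_pt k j) = gam k (Some (tpts k \<delta> a j))"
    unfolding apply_aut_coord_pt[OF cS j] gam_Some
    using m j b(1) lag_coeff_nonzero[OF inj sum j] by (simp add: proj_pt_smult)
qed

end

text \<open>The map F determines S and T only up to a common diagonal factor and relabelling. They
  are therefore bound inside the unique existence of the pair (F, \<tau>), and the formula for S is
  asserted for every admissible choice.\<close>

theorem theorem2p6:
  fixes k :: nat and \<delta> :: complex and tp :: "nat \<Rightarrow> complex"
  assumes "k \<ge> 2"
    and "\<delta> \<noteq> 0"
    and "inj_on tp {0..k}"
    and "(\<Sum>j=0..k. tp j) \<noteq> 0"
  shows "(\<exists>!p. case p of (F, \<tau>) \<Rightarrow>
            \<exists>S T. basic_cremona k S T F \<and>
                  properly_fixes_by k F \<delta> \<tau> \<and>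
                  (\<forall>j\<le>k. apply_aut T (coord_pt k j) = gam k (Some (tp j)))) \<and>
         (\<forall>F \<tau> S T. basic_cremona k S T F \<longrightarrow>
            properly_fixes_by k F \<delta> \<tau> \<longrightarrow>
            (\<forall>j\<le>k. apply_aut T (coord_pt k j) = gam k (Some (tp j))) \<longrightarrow>
            \<tau> = (of_nat k - 1) / (of_nat k + 1) * \<delta> * (\<Sum>j=0..k. tp j) \<and>
            (\<forall>j\<le>k. apply_aut S (coord_pt k j) =
                     gam k (Some (\<delta> * tp j - 2 * \<tau> / (of_nat k - 1)))))"
proof -
  have sum: "asum k tp \<noteq> 0" using assms(4) by (simp add: asum_def)
  note unique = basic_cremona_unique[OF assms(1-3) sum]
  show ?thesis
  proof (intro conjI allI impI ex1I[of _ "(sol k \<delta> tp, tshift k \<delta> tp)"])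
    show "case (sol k \<delta> tp, tshift k \<delta> tp) of (F, \<tau>) \<Rightarrow> \<exists>S T. basic_cremona k S T F \<and>
        properly_fixes_by k F \<delta> \<tau> \<and> (\<forall>j\<le>k. apply_aut T (coord_pt k j) = gam k (Some (tp j)))"
      unfolding prod.case
      using basic_cremona_sol[OF assms(1-3) sum] properly_fixes_by_sol[OF assms(1-3) sum] apply_aut_Gam
      by blast
  next
    fix p
    assume "case p of (F, \<tau>) \<Rightarrow> \<exists>S T. basic_cremona k S T F \<and>
      properly_fixes_by k F \<delta> \<tau> \<and> (\<forall>j\<le>k. apply_aut T (coord_pt k j) = gam k (Some (tp j)))"
    then show "p = (sol k \<delta> tp, tshift k \<delta> tp)"
      using unique(1,2) by (cases p) (auto simp del: gam.simps)
  next
    fix F \<tau> S T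
    assume *: "basic_cremona k S T F" "properly_fixes_by k F \<delta> \<tau>"
      "\<forall>j\<le>k. apply_aut T (coord_pt k j) = gam k (Some (tp j))"
    have \<tau>: "\<tau> = tshift k \<delta> tp" by (rule unique(1)[OF *(1,2)]) (use *(3) in blast)
    then show "\<tau> = (of_nat k - 1) / (of_nat k + 1) * \<delta> * (\<Sum>j=0..k. tp j)"
      by (simp add: tshift_def asum_def)
    show "apply_aut S (coord_pt k j) = gam k (Some (\<delta> * tp j - 2 * \<tau> / (of_nat k - 1)))" if "j \<le> k" for j
      unfolding \<tau> tpts_eq[OF assms(1), symmetric]
      by (rule unique(3)[OF *(1,2) _ that]) (use *(3) in blast)
  qed
qed

end
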